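(* Let $\omega\in C(\mathbb{T})$ be a weight function such that, for some $\epsilon>0$, $\omega$ is decreasing on $(-\epsilon,0)$, $\omega(0)=0$, $\omega$ is increasing on $(0,\epsilon)$, and moreover $$\lim_{t\to0}\frac{\log\omega(rt)}{\log\omega(t)}=\infty\quad\text{for each } r\in(0,1).$$ Then for each $0<p\le\infty$ there exists a sequence of trigonometric polynomials $Q_n$ of degree at most $n$ such that $$\lim_{n\to\infty}\frac{\|Q_n'\|_{L_p(\omega)}}{n\|Q_n\|_{L_p(\omega)}}=\infty.$$
   Context: $\mathbb{T}=\mathbb{R}/2\pi\mathbb{Z}$. A weight is a nonnegative integrable function on $\mathbb{T}$. $\|f\|_{L_p(\omega)}=\left(\int_{\mathbb{T}}|f|^p\omega\right)^{1/p}$ if $0<p<\infty$, and $\|f\|_{L_\infty(\omega)}=\operatorname{ess\,sup}_{t\in\mathbb{T}}|f(t)\omega(t)|$. As is implicit in the use of $\log\omega$, $\omega(t)>0$ for $t\neq 0$ near $0$. *)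

theory Defs
  imports "HOL-Probability.Essential_Supremum"
begin

(* A function on the circle R/2piZ is a 2pi-periodic function on the reals, and
   integrals over the circle are taken over the fundamental domain [-pi, pi]. *)

definition torus_fun :: "(real \<Rightarrow> 'a) \<Rightarrow> bool" where
  "torus_fun f \<longleftrightarrow> (\<forall>t. f (t + 2 * pi) = f t)"

abbreviation torus_measure :: "real measure" where
  "torus_measure \<equiv> lebesgue_on {-pi..pi}"

definition weight :: "(real \<Rightarrow> real) \<Rightarrow> bool" where
  "weight \<omega> \<longleftrightarrow> torus_fun \<omega> \<and> (\<forall>t. 0 \<le> \<omega> t) \<and> integrable torus_measure \<omega>"

(* The weight enters the sup norm as a factor of f. The value is a real number,
   hence only meaningful when the integral converges, respectively the essential
   supremum is finite; both hold when f and the weight are continuous. *)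
definition weighted_norm :: "ennreal \<Rightarrow> (real \<Rightarrow> real) \<Rightarrow> (real \<Rightarrow> real) \<Rightarrow> real" where
  "weighted_norm p \<omega> f =
     (if p = \<infinity> then real_of_ereal (esssup torus_measure (\<lambda>t. ereal \<bar>f t * \<omega> t\<bar>))
      else (\<integral>t. \<bar>f t\<bar> powr enn2real p * \<omega> t \<partial>torus_measure) powr (1 / enn2real p))"

definition trig_poly :: "nat \<Rightarrow> (real \<Rightarrow> real) \<Rightarrow> bool" where
  "trig_poly n Q \<longleftrightarrow>
     (\<exists>a b :: nat \<Rightarrow> real. \<forall>t.
        Q t = a 0 + (\<Sum>k=1..n. a k * cos (real k * t) + b k * sin (real k * t)))"

end

theory Submission
  imports Defs
begin

text \<open>
The failure of the Bernstein inequality comes from the behaviour of polynomials at the end of an arc.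
A weight whose logarithm changes by an arbitrarily large factor when \<open>t\<close> changes by a factor close
to 1 looks to polynomials of degree \<open>n\<close> like the indicator function of the complement of an arc from 0
to \<open>\<beta>\<close>, where \<open>\<beta>\<close> depends on \<open>n\<close> through \<open>- ln (\<omega> \<beta>) = n \<beta>\<close>: slightly inside the arc the weight is so
small that no growth of the polynomial can compensate for it, and slightly outside it is not small at
all on the scale \<open>exp (n \<beta>)\<close>.

For such an arc, the Chebyshev polynomial transplanted to the circle (\<open>arc_cheb\<close>) is bounded by 1 outside
and of size \<open>exp (n sqrt (t (\<beta> - t)))\<close>, up to a constant in the exponent, inside. At distance \<open>\<eta> \<beta>\<close> from the
endpoint this is \<open>exp (c n \<beta> sqrt \<eta>)\<close>. A Bernstein inequality with constant \<open>C n\<close> would imply, by Taylor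
expansion, that a translation by \<open>\<eta> \<beta>\<close> costs at most a factor \<open>exp (4 C n \<beta> \<eta>)\<close> (\<open>shift_bound\<close>). For \<open>\<eta>\<close>
small compared with \<open>1 / C\<^sup>2\<close> the two are incompatible as soon as \<open>n \<beta>\<close> is large
(\<open>bernstein_violation\<close>). It becomes large because \<open>n \<beta> = - ln (\<omega> \<beta>)\<close> and \<open>\<beta>\<close> tends to 0 as \<open>n\<close> grows
(\<open>bernstein_fails_eventually\<close>). So for each \<open>C\<close> the inequality fails for all large \<open>n\<close>, and a diagonal
choice of counterexamples gives the sequence.

The case \<open>p < 1\<close>, in which there is no triangle inequality, is not special: instead of adding norms of
Taylor terms, one large term is selected at each point (\<open>shift_dichotomy\<close>, \<open>norm_power_sum_ge\<close>).
\<close>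

section \<open>Trigonometric polynomials and their derivatives\<close>

lemma trig_poly_zero: "trig_poly n (\<lambda>_. 0)"
  unfolding trig_poly_def by (intro exI[of _ "\<lambda>_. 0"]) simp

lemma trig_poly_add:
  assumes "trig_poly n f" "trig_poly n g" shows "trig_poly n (\<lambda>t. f t + g t)"
proof -
  from assms obtain a b a' b' where
    "\<And>t. f t = a 0 + (\<Sum>k=1..n. a k * cos (real k * t) + b k * sin (real k * t))"
    "\<And>t. g t = a' 0 + (\<Sum>k=1..n. a' k * cos (real k * t) + b' k * sin (real k * t))"
    unfolding trig_poly_def by auto
  then show ?thesis unfolding trig_poly_def
    by (intro exI[of _ "\<lambda>k. a k + a' k"] exI[of _ "\<lambda>k. b k + b' k"])
       (simp add: sum.distrib algebra_simps)
qed

lemma trig_poly_scale: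
  assumes "trig_poly n f" shows "trig_poly n (\<lambda>t. c * f t)"
proof -
  from assms obtain a b where
    "\<And>t. f t = a 0 + (\<Sum>k=1..n. a k * cos (real k * t) + b k * sin (real k * t))"
    unfolding trig_poly_def by auto
  then show ?thesis unfolding trig_poly_def
    by (intro exI[of _ "\<lambda>k. c * a k"] exI[of _ "\<lambda>k. c * b k"])
       (simp add: sum_distrib_left algebra_simps)
qed

lemma trig_poly_sum:
  assumes "\<And>i. i \<in> A \<Longrightarrow> trig_poly n (f i)"
  shows "trig_poly n (\<lambda>t. \<Sum>i\<in>A. f i t)"
  using assms by (induction A rule: infinite_finite_induct)
    (auto intro: trig_poly_zero trig_poly_add)

lemma trig_poly_const: "trig_poly n (\<lambda>_. c)"
  unfolding trig_poly_def
  by (intro exI[of _ "\<lambda>k. if k = 0 then c else 0"] exI[of _ "\<lambda>_. 0"]) simp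

lemma trig_poly_cos:
  assumes "k \<le> n" shows "trig_poly n (\<lambda>t. cos (real k * t))"
proof (cases "k = 0")
  case True then show ?thesis by (simp add: trig_poly_const)
next
  case False
  with False assms show ?thesis
    unfolding trig_poly_def
    by (intro exI[of _ "\<lambda>j. if j = k then 1 else 0"] exI[of _ "\<lambda>_. 0"])
       (simp add: if_distrib if_distribR cong: if_cong)
qed

lemma trig_poly_sin:
  assumes "k \<le> n" shows "trig_poly n (\<lambda>t. sin (real k * t))"
proof (cases "k = 0")
  case True then show ?thesis by (simp add: trig_poly_const)
next
  case False
  with assms show ?thesis
    unfolding trig_poly_def
    by (intro exI[of _ "\<lambda>_. 0"] exI[of _ "\<lambda>j. if j = k then 1 else 0"])
       (simp add: if_distrib if_distribR cong: if_cong)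
qed

lemma trig_poly_mono:
  assumes "trig_poly m f" "m \<le> n" shows "trig_poly n f"
proof -
  from assms(1) obtain a b where f:
    "\<And>t. f t = a 0 + (\<Sum>k=1..m. a k * cos (real k * t) + b k * sin (real k * t))"
    unfolding trig_poly_def by auto
  have "trig_poly n (\<lambda>t. a 0 + (\<Sum>k=1..m. a k * cos (real k * t) + b k * sin (real k * t)))"
    using assms(2)
    by (intro trig_poly_add trig_poly_const trig_poly_sum trig_poly_scale trig_poly_cos trig_poly_sin) auto
  then show ?thesis using f by presburger
qed

lemma trig_poly_mult_cos:
  assumes "trig_poly n f" shows "trig_poly (Suc n) (\<lambda>t. cos (t - c) * f t)"
proof -
  from assms obtain a b where f:
    "\<And>t. f t = a 0 + (\<Sum>k=1..n. a k * cos (real k * t) + b k * sin (real k * t))"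
    unfolding trig_poly_def by auto
  have c: "trig_poly (Suc n) (\<lambda>t. cos (t - c) * cos (real k * t))" if "k \<le> n" for k
  proof (cases "k = 0")
    case True
    have "cos (t - c) * cos (real k * t) = cos c * cos (real 1 * t) + sin c * sin (real 1 * t)" for t
      using True by (simp add: cos_diff)
    then show ?thesis
      by (simp only:) (intro trig_poly_add trig_poly_scale trig_poly_cos trig_poly_sin; simp)
  next
    case False
    have "cos (t - c) * cos (real k * t) =
      ((cos c / 2) * cos (real (Suc k) * t) + (sin c / 2) * sin (real (Suc k) * t)) +
      ((cos c / 2) * cos (real (k - 1) * t) + (- (sin c) / 2) * sin (real (k - 1) * t))" for t
    proof -
      have e: "real (Suc k) * t = real k * t + t" "real (k - 1) * t = real k * t - t"
        using False by (auto simp: algebra_simps of_nat_diff)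
      show ?thesis unfolding e cos_add cos_diff sin_add sin_diff by (simp add: field_simps)
    qed
    then show ?thesis using that
      by (simp only:) (intro trig_poly_add trig_poly_scale trig_poly_cos trig_poly_sin; simp)
  qed
  have s: "trig_poly (Suc n) (\<lambda>t. cos (t - c) * sin (real k * t))" if "k \<le> n" for k
  proof (cases "k = 0")
    case True then show ?thesis by (simp add: trig_poly_zero)
  next
    case False
    have "cos (t - c) * sin (real k * t) =
      ((cos c / 2) * sin (real (Suc k) * t) + (- (sin c) / 2) * cos (real (Suc k) * t)) +
      ((cos c / 2) * sin (real (k - 1) * t) + (sin c / 2) * cos (real (k - 1) * t))" for t
    proof -
      have e: "real (Suc k) * t = real k * t + t" "real (k - 1) * t = real k * t - t"
        using False by (auto simp: algebra_simps of_nat_diff)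
      show ?thesis unfolding e cos_add cos_diff sin_add sin_diff by (simp add: field_simps)
    qed
    then show ?thesis using that
      by (simp only:) (intro trig_poly_add trig_poly_scale trig_poly_cos trig_poly_sin; simp)
  qed
  have "trig_poly (Suc n) (\<lambda>t. a 0 * (cos (t - c) * cos (real 0 * t)) +
      (\<Sum>k=1..n. a k * (cos (t - c) * cos (real k * t)) + b k * (cos (t - c) * sin (real k * t))))"
    by (intro trig_poly_add trig_poly_sum trig_poly_scale c s) auto
  also have "(\<lambda>t. a 0 * (cos (t - c) * cos (real 0 * t)) +
      (\<Sum>k=1..n. a k * (cos (t - c) * cos (real k * t)) + b k * (cos (t - c) * sin (real k * t)))) =
      (\<lambda>t. cos (t - c) * f t)"
    by (simp add: f sum_distrib_left algebra_simps)
  finally show ?thesis .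
qed

text \<open>
Every differentiation multiplies the coefficients by at most \<open>n\<close>, so the bound \<open>M\<close> is the sum of the
absolute values of the coefficients of \<open>Q\<close>. The geometric growth in \<open>k\<close> is what makes the Taylor
series of \<open>Q\<close> converge, uniformly in the centre.
\<close>

lemma trig_poly_iterated_deriv_bound:
  assumes "trig_poly n Q"
  shows "\<exists>M\<ge>0. \<forall>k. trig_poly n ((deriv ^^ k) Q) \<and>
    (\<forall>t. ((deriv ^^ k) Q has_real_derivative (deriv ^^ Suc k) Q t) (at t)) \<and>
    (\<forall>t. \<bar>(deriv ^^ k) Q t\<bar> \<le> M * real n ^ k)"
proof -
  \<comment> \<open>Tracking the coefficients makes the bound an invariant of differentiation.\<close>
  define rep where "rep f B \<longleftrightarrow> (\<exists>a b :: nat \<Rightarrow> real.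
     (\<forall>t. f t = a 0 + (\<Sum>k=1..n. a k * cos (real k * t) + b k * sin (real k * t))) \<and>
     \<bar>a 0\<bar> + (\<Sum>k=1..n. \<bar>a k\<bar> + \<bar>b k\<bar>) \<le> B)" for f :: "real \<Rightarrow> real" and B
  have step: "(\<forall>t. (f has_real_derivative deriv f t) (at t)) \<and> rep (deriv f) (real n * B) \<and>
      (\<forall>t. \<bar>f t\<bar> \<le> B) \<and> trig_poly n f" if r: "rep f B" for f B
  proof -
    from r obtain a b :: "nat \<Rightarrow> real" where f:
      "\<And>t. f t = a 0 + (\<Sum>k=1..n. a k * cos (real k * t) + b k * sin (real k * t))"
      and B: "\<bar>a 0\<bar> + (\<Sum>k=1..n. \<bar>a k\<bar> + \<bar>b k\<bar>) \<le> B" unfolding rep_def by auto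
    let ?D = "\<lambda>t. \<Sum>k=1..n. (real k * b k) * cos (real k * t) + (- real k * a k) * sin (real k * t)"
    have ff: "f = (\<lambda>t. a 0 + (\<Sum>k=1..n. a k * cos (real k * t) + b k * sin (real k * t)))"
      using f by auto
    have D: "(f has_real_derivative ?D t) (at t)" for t
      unfolding ff by (rule derivative_eq_intros refl | simp)+ (auto intro!: sum.cong)
    then have dv: "deriv f = ?D" by (auto intro: DERIV_imp_deriv)
    have "(\<Sum>k=1..n. \<bar>real k * b k\<bar> + \<bar>- real k * a k\<bar>) \<le> (\<Sum>k=1..n. real n * (\<bar>a k\<bar> + \<bar>b k\<bar>))"
      by (rule sum_mono) (auto simp: abs_mult algebra_simps intro!: add_mono mult_right_mono)
    also have "\<dots> = real n * (\<Sum>k=1..n. \<bar>a k\<bar> + \<bar>b k\<bar>)" by (simp add: sum_distrib_left)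
    also have "\<dots> \<le> real n * B" using B by (intro mult_left_mono) auto
    finally have "rep (deriv f) (real n * B)"
      unfolding rep_def dv
      by (intro exI[of _ "\<lambda>k. real k * b k"] exI[of _ "\<lambda>k. - real k * a k"]) auto
    moreover have "\<bar>f t\<bar> \<le> B" for t
    proof -
      have "\<bar>f t\<bar> \<le> \<bar>a 0\<bar> + \<bar>\<Sum>k=1..n. a k * cos (real k * t) + b k * sin (real k * t)\<bar>"
        unfolding f by linarith
      also have "\<bar>\<Sum>k=1..n. a k * cos (real k * t) + b k * sin (real k * t)\<bar> \<le>
          (\<Sum>k=1..n. \<bar>a k * cos (real k * t) + b k * sin (real k * t)\<bar>)" by (rule sum_abs)
      also have "\<dots> \<le> (\<Sum>k=1..n. \<bar>a k\<bar> + \<bar>b k\<bar>)"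
      proof (rule sum_mono)
        fix k
        have "\<bar>a k * cos (real k * t)\<bar> \<le> \<bar>a k\<bar>" "\<bar>b k * sin (real k * t)\<bar> \<le> \<bar>b k\<bar>"
          by (auto simp: abs_mult intro!: mult_left_le)
        then show "\<bar>a k * cos (real k * t) + b k * sin (real k * t)\<bar> \<le> \<bar>a k\<bar> + \<bar>b k\<bar>" by linarith
      qed
      finally show ?thesis using B by linarith
    qed
    moreover have "trig_poly n f" unfolding trig_poly_def using f by blast
    ultimately show ?thesis using D dv by auto
  qed
  obtain a b :: "nat \<Rightarrow> real" where
    "\<forall>t. Q t = a 0 + (\<Sum>k=1..n. a k * cos (real k * t) + b k * sin (real k * t))"
    using assms unfolding trig_poly_def by auto
  then have r0: "rep Q (\<bar>a 0\<bar> + (\<Sum>k=1..n. \<bar>a k\<bar> + \<bar>b k\<bar>))" (is "rep Q ?M")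
    unfolding rep_def by blast
  have rk: "rep ((deriv ^^ k) Q) (?M * real n ^ k)" for k
  proof (induction k)
    case 0 then show ?case using r0 by simp
  next
    case (Suc k) then show ?case using step[OF Suc] by (simp add: mult_ac)
  qed
  show ?thesis
  proof (intro exI[of _ ?M] conjI allI)
    show "0 \<le> ?M" by (intro add_nonneg_nonneg sum_nonneg) auto
  qed (use step[OF rk] in auto)
qed

section \<open>Chebyshev polynomials\<close>

fun cheb :: "nat \<Rightarrow> real \<Rightarrow> real" where
  "cheb 0 x = 1" | "cheb (Suc 0) x = x" | "cheb (Suc (Suc n)) x = 2 * x * cheb (Suc n) x - cheb n x"

lemma cheb_cos: "cheb n (cos x) = cos (real n * x)"
proof (induction n rule: induct_nat_012)
  case (ge2 n)
  have e: "real (Suc (Suc n)) * x = real (Suc n) * x + x" "real n * x = real (Suc n) * x - x"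
    by (auto simp: algebra_simps)
  have "cheb (Suc (Suc n)) (cos x) = 2 * cos x * cos (real (Suc n) * x) - cos (real n * x)" using ge2 by simp
  also have "\<dots> = cos (real (Suc (Suc n)) * x)" unfolding e cos_add cos_diff by (simp add: algebra_simps)
  finally show ?case .
qed auto

lemma cheb_cosh: "cheb n (cosh x) = cosh (real n * x)"
proof (induction n rule: induct_nat_012)
  case (ge2 n)
  have e: "real (Suc (Suc n)) * x = real (Suc n) * x + x" "real n * x = real (Suc n) * x - x"
    by (auto simp: algebra_simps)
  have "cheb (Suc (Suc n)) (cosh x) = 2 * cosh x * cosh (real (Suc n) * x) - cosh (real n * x)" using ge2 by simp
  also have "\<dots> = cosh (real (Suc (Suc n)) * x)" unfolding e cosh_add cosh_diff by (simp add: algebra_simps)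
  finally show ?case .
qed auto

lemma trig_poly_cheb: "trig_poly n (\<lambda>t. cheb n (A * cos (t - c) + B))"
proof (induction n rule: induct_nat_012)
  case 0 then show ?case by (simp add: trig_poly_const)
next
  case 1
  have "trig_poly (Suc 0) (\<lambda>t. A * (cos (t - c) * 1) + B)"
    by (intro trig_poly_add trig_poly_scale trig_poly_mult_cos trig_poly_const)
  then show ?case by simp
next
  case (ge2 n)
  have "trig_poly (Suc (Suc n)) (\<lambda>t. (2 * A) * (cos (t - c) * cheb (Suc n) (A * cos (t - c) + B)) +
     ((2 * B) * cheb (Suc n) (A * cos (t - c) + B) + (-1) * cheb n (A * cos (t - c) + B)))"
    using ge2 by (intro trig_poly_add trig_poly_scale trig_poly_mult_cos) (auto intro: trig_poly_mono)
  then show ?case by (simp add: algebra_simps)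
qed

text \<open>
Half-angle form, from which both quadratic estimates of \<open>cosh y - 1\<close> follow by estimating
\<open>exp (y/2) - exp (- y/2)\<close>.
\<close>

lemma cosh_minus_one: "cosh (y::real) - 1 = (exp (y/2) - exp (- y/2))\<^sup>2 / 2"
proof -
  have "(exp (y/2))\<^sup>2 = exp y" "(exp (- y/2))\<^sup>2 = exp (- y)" "exp (y/2) * exp (- y/2) = 1"
    by (simp_all add: power2_eq_square flip: exp_add)
  then show ?thesis by (simp add: power2_diff cosh_field_def field_simps)
qed

lemma cosh_lower: assumes "0 \<le> (y::real)" shows "y\<^sup>2 \<le> 8 * (cosh y - 1)"
proof -
  have "y/2 \<le> exp (y/2) - exp (- y/2)"
    using exp_ge_add_one_self[of "y/2"] assms by (smt (verit) exp_le_one_iff divide_minus_left half_gt_zero_iff)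
  then have "(y/2)\<^sup>2 \<le> (exp (y/2) - exp (- y/2))\<^sup>2" using assms by (intro power_mono) auto
  then show ?thesis unfolding cosh_minus_one by (simp add: power_divide)
qed

lemma cosh_upper: assumes "0 \<le> (y::real)" "y \<le> 1" shows "cosh y - 1 \<le> 2 * y\<^sup>2"
proof -
  have "exp (y/2) - exp (- y/2) = exp (-y/2) * (exp y - 1)"
    by (simp add: algebra_simps flip: exp_add)
  also have "\<dots> \<le> 1 * (y + y\<^sup>2)"
    using exp_bound[of y] assms by (intro mult_mono) auto
  also have "\<dots> \<le> 2 * y" using assms by (simp add: power2_eq_square mult_left_le)
  finally have "(exp (y/2) - exp (- y/2))\<^sup>2 \<le> (2*y)\<^sup>2" using assms by (intro power_mono) auto
  then show ?thesis unfolding cosh_minus_one by (simp add: power_mult_distrib)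
qed

section \<open>The weighted quasi-norms\<close>

lemma exp_ge_power_div_fact:
  fixes x :: real
  assumes "0 \<le> x" shows "x ^ k / fact k \<le> exp x"
proof -
  have "(\<Sum>n\<in>{k}. x ^ n /\<^sub>R fact n) \<le> (\<Sum>n. x ^ n /\<^sub>R fact n)"
    using assms exp_converges[of x] by (intro sum_le_suminf) (auto simp: sums_iff)
  then show ?thesis using exp_converges[of x] by (simp add: sums_iff field_simps)
qed

text \<open>
The exponent for which \<open>|f|\<close> raised to it, times \<open>\<omega>\<close>, is the density that the norm measures: for finite
\<open>p\<close> this is \<open>p\<close>, but for \<open>p = \<infinity>\<close> the weight enters as a factor, hence the value 1. The power of
the norm with this exponent lets finite and infinite \<open>p\<close> be treated by the same estimates.
\<close>

definition norm_exponent :: "ennreal \<Rightarrow> real" where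
  "norm_exponent p = (if p = \<infinity> then 1 else enn2real p)"

definition norm_power :: "ennreal \<Rightarrow> (real \<Rightarrow> real) \<Rightarrow> (real \<Rightarrow> real) \<Rightarrow> real" where
  "norm_power p \<omega> f = weighted_norm p \<omega> f powr norm_exponent p"

lemma norm_exponent_pos: "0 < p \<Longrightarrow> 0 < norm_exponent p"
  unfolding norm_exponent_def by (auto simp: enn2real_positive_iff less_top)

lemma AE_torus_not_False: "\<not> (AE t in torus_measure. False)"
proof
  assume "AE t in torus_measure. False"
  then have "emeasure torus_measure {t \<in> space torus_measure. \<not> False} = 0"
    by (rule AE_E2)
  moreover have "{t \<in> space torus_measure. \<not> False} = {-pi..pi}" by auto
  ultimately show False by (simp add: emeasure_restrict_space)
qed

lemma weighted_norm_nonneg: "0 \<le> weighted_norm p \<omega> f"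
proof (cases "p = \<infinity>")
  case True
  have "0 \<le> esssup torus_measure (\<lambda>t. ereal \<bar>f t * \<omega> t\<bar>)"
  proof (rule ccontr)
    assume neg: "\<not> ?thesis"
    have "AE t in torus_measure. ereal \<bar>f t * \<omega> t\<bar> \<le> esssup torus_measure (\<lambda>t. ereal \<bar>f t * \<omega> t\<bar>)"
      by (rule esssup_AE)
    then have "AE t in torus_measure. False"
    proof (rule AE_mp, intro AE_I2 impI)
      fix t assume "ereal \<bar>f t * \<omega> t\<bar> \<le> esssup torus_measure (\<lambda>t. ereal \<bar>f t * \<omega> t\<bar>)"
      with neg have "ereal \<bar>f t * \<omega> t\<bar> < 0" by (meson not_le order.strict_trans1)
      then show False by simp
    qed
    then show False using AE_torus_not_False by blast
  qed
  then show ?thesis using True by (simp add: weighted_norm_def real_of_ereal_pos)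
qed (simp add: weighted_norm_def)

context
  fixes \<omega> :: "real \<Rightarrow> real"
  assumes cont: "continuous_on UNIV \<omega>" and nonneg: "\<And>t. 0 \<le> \<omega> t"
begin

lemma torus_integrable:
  assumes "continuous_on UNIV f" "0 < q"
  shows "integrable torus_measure (\<lambda>t. \<bar>f t\<bar> powr q * \<omega> t)"
proof (rule continuous_imp_integrable_real)
  have "continuous_on {-pi..pi} f" "continuous_on {-pi..pi} \<omega>"
    using assms(1) cont by (auto intro: continuous_on_subset)
  then show "continuous_on {-pi..pi} (\<lambda>t. \<bar>f t\<bar> powr q * \<omega> t)"
    using assms(2) by (intro continuous_intros continuous_on_powr') auto
qed

lemma norm_power_eq_integral:
  assumes "0 < p" "p \<noteq> \<infinity>"
  shows "norm_power p \<omega> f = (\<integral>t. \<bar>f t\<bar> powr norm_exponent p * \<omega> t \<partial>torus_measure)"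
proof -
  have "0 \<le> (\<integral>t. \<bar>f t\<bar> powr norm_exponent p * \<omega> t \<partial>torus_measure)"
    using nonneg by (intro Bochner_Integration.integral_nonneg) auto
  then show ?thesis
    using norm_exponent_pos[OF assms(1)] assms
    by (simp add: norm_power_def weighted_norm_def norm_exponent_def powr_powr)
qed

lemma torus_AE_le_weighted_norm:
  assumes "continuous_on UNIV f"
  shows "AE t in torus_measure. \<bar>f t\<bar> * \<omega> t \<le> weighted_norm \<infinity> \<omega> f"
proof -
  let ?g = "\<lambda>t. \<bar>f t * \<omega> t\<bar>"
  let ?E = "esssup torus_measure (\<lambda>t. ereal (?g t))"
  have cg: "continuous_on {-pi..pi} ?g"
    using assms cont by (intro continuous_intros) (auto intro: continuous_on_subset)
  then have "?g \<in> borel_measurable torus_measure"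
    by (intro borel_measurable_integrable continuous_imp_integrable_real)
  then have meas: "(\<lambda>t. ereal (?g t)) \<in> borel_measurable torus_measure" by measurable
  obtain B where B: "\<And>t. t \<in> {-pi..pi} \<Longrightarrow> ?g t \<le> B"
    using continuous_attains_sup[OF _ _ cg] by fastforce
  have le: "?E \<le> ereal B"
    by (rule esssup_I[OF meas]) (use B in \<open>auto intro!: AE_I2\<close>)
  have AE: "AE t in torus_measure. ereal (?g t) \<le> ?E" by (rule esssup_AE)
  have "?E \<noteq> \<infinity>" using le by auto
  have "?g t \<le> weighted_norm \<infinity> \<omega> f" if "ereal (?g t) \<le> ?E" for t
    using that \<open>?E \<noteq> \<infinity>\<close> unfolding weighted_norm_def by (cases ?E) auto
  then show ?thesis using AE nonneg by (auto simp: abs_mult elim!: eventually_mono)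
qed

text \<open>
For \<open>p = \<infinity>\<close> the bound \<open>M\<close> itself would do; the factor is the length of the circle, which the integral
needs.
\<close>

lemma norm_power_le:
  assumes f: "continuous_on UNIV f" and p: "0 < p"
    and bd: "\<And>t. t \<in> {-pi..pi} \<Longrightarrow> \<bar>f t\<bar> powr norm_exponent p * \<omega> t \<le> M"
  shows "norm_power p \<omega> f \<le> 2 * pi * M"
proof -
  have "0 \<le> \<bar>f 0\<bar> powr norm_exponent p * \<omega> 0" using nonneg by simp
  also have "\<dots> \<le> M" by (rule bd) simp
  finally have M: "0 \<le> M" .
  show ?thesis
  proof (cases "p = \<infinity>")
    case True
    have "continuous_on {-pi..pi} (\<lambda>t. \<bar>f t * \<omega> t\<bar>)"
      using f cont by (intro continuous_intros) (auto intro: continuous_on_subset)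
    then have "(\<lambda>t. \<bar>f t * \<omega> t\<bar>) \<in> borel_measurable torus_measure"
      by (intro borel_measurable_integrable continuous_imp_integrable_real)
    then have "esssup torus_measure (\<lambda>t. ereal \<bar>f t * \<omega> t\<bar>) \<le> ereal M"
      using bd True nonneg by (intro esssup_I AE_I2) (auto simp: abs_mult norm_exponent_def)
    then have "weighted_norm p \<omega> f \<le> M" unfolding weighted_norm_def using True M
      by (cases "esssup torus_measure (\<lambda>t. ereal \<bar>f t * \<omega> t\<bar>)") auto
    then have "norm_power p \<omega> f \<le> M"
      using weighted_norm_nonneg[of p \<omega> f] True by (simp add: norm_power_def norm_exponent_def)
    also have "\<dots> \<le> 2 * pi * M" using M pi_gt3 by (simp add: mult_le_cancel_right1)
    finally show ?thesis .
  next
    case False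
    have "norm_power p \<omega> f = (\<integral>t. \<bar>f t\<bar> powr norm_exponent p * \<omega> t \<partial>torus_measure)"
      by (rule norm_power_eq_integral[OF p False])
    also have "\<dots> \<le> (\<integral>t. M \<partial>torus_measure)"
      using bd by (intro Bochner_Integration.integral_mono torus_integrable f norm_exponent_pos p
        continuous_imp_integrable_real) auto
    also have "\<dots> = 2 * pi * M" by (simp add: measure_restrict_space)
    finally show ?thesis .
  qed
qed

text \<open>
If at each point of an interval one of finitely many functions is large, then one of them has a large
norm. The index \<open>k\<close> may depend on the point. Summing the powers of the norms replaces the triangle
inequality, which fails for \<open>p < 1\<close>; for finite \<open>p\<close> the inequality is integrated over the interval, for
\<open>p = \<infinity>\<close> a single point outside a null set suffices, and \<open>l \<le> 1\<close> puts the result into the same form.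
\<close>

lemma norm_power_sum_ge:
  fixes f :: "nat \<Rightarrow> real \<Rightarrow> real"
  assumes f: "\<And>k. continuous_on UNIV (f k)" and p: "0 < p" and c: "\<And>k. 0 \<le> c k" and L: "0 < L"
    and I: "-pi \<le> x" "x + l \<le> pi" "0 < l" "l \<le> 1"
    and w: "\<And>t. t \<in> {x..x+l} \<Longrightarrow> w \<le> \<omega> t" "0 \<le> w"
    and big: "\<And>t. t \<in> {x..x+l} \<Longrightarrow> \<exists>k<N. L \<le> c k * \<bar>f k t\<bar>"
  shows "L powr norm_exponent p * w * l \<le> (\<Sum>k<N. c k powr norm_exponent p * norm_power p \<omega> (f k))"
proof (cases "p = \<infinity>")
  case True
  have "AE t in torus_measure. \<forall>k\<in>{..<N}. \<bar>f k t\<bar> * \<omega> t \<le> weighted_norm \<infinity> \<omega> (f k)"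
    by (rule AE_finite_allI[OF finite_lessThan torus_AE_le_weighted_norm[OF f]])
  then have AE: "AE t in torus_measure. t \<notin> {x..x+l} \<or>
      L * w \<le> (\<Sum>k<N. c k * weighted_norm \<infinity> \<omega> (f k))"
  proof (rule AE_mp, intro AE_I2 impI disjCI)
    fix t assume h: "\<forall>k\<in>{..<N}. \<bar>f k t\<bar> * \<omega> t \<le> weighted_norm \<infinity> \<omega> (f k)" "\<not> (L * w \<le> (\<Sum>k<N. c k * weighted_norm \<infinity> \<omega> (f k)))"
    show "t \<notin> {x..x+l}"
    proof
      assume t: "t \<in> {x..x+l}"
      then obtain k where k: "k < N" "L \<le> c k * \<bar>f k t\<bar>" using big by blast
      have "L * w \<le> (c k * \<bar>f k t\<bar>) * \<omega> t" using k w t L by (intro mult_mono) auto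
      also have "\<dots> = c k * (\<bar>f k t\<bar> * \<omega> t)" by simp
      also have "\<dots> \<le> c k * weighted_norm \<infinity> \<omega> (f k)" using h(1) k(1) c by (intro mult_left_mono) auto
      also have "\<dots> \<le> (\<Sum>k<N. c k * weighted_norm \<infinity> \<omega> (f k))"
        using k(1) c weighted_norm_nonneg by (intro member_le_sum) auto
      finally show False using h(2) by simp
    qed
  qed
  have "L * w \<le> (\<Sum>k<N. c k * weighted_norm \<infinity> \<omega> (f k))"
  proof (rule ccontr)
    assume "\<not> ?thesis"
    with AE have AE2: "AE t in torus_measure. t \<notin> {x..x+l}" by simp
    have "emeasure torus_measure {t \<in> space torus_measure. t \<in> {x..x+l}} = 0"
      using AE_E2[OF AE2] by simp
    moreover have "{t \<in> space torus_measure. t \<in> {x..x+l}} = {x..x+l}" using I by auto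
    moreover have "emeasure torus_measure {x..x+l} = ennreal l"
      using I by (subst emeasure_restrict_space) auto
    ultimately show False using I by simp
  qed
  moreover have "L * w * l \<le> L * w" using I L w by (simp add: mult_left_le)
  ultimately have "L * w * l \<le> (\<Sum>k<N. c k * weighted_norm \<infinity> \<omega> (f k))" by linarith
  then show ?thesis using True L c weighted_norm_nonneg
    by (simp add: norm_power_def norm_exponent_def)
next
  case False
  let ?q = "norm_exponent p"
  have q: "0 < ?q" by (rule norm_exponent_pos[OF p])
  have sets: "{x..x+l} \<in> sets torus_measure"
    using I by (subst sets_restrict_space_iff) auto
  have fin: "emeasure torus_measure {x..x+l} = ennreal l"
    using I by (subst emeasure_restrict_space) auto
  have "L powr ?q * w * l = (\<integral>t. (L powr ?q * w) * indicator {x..x+l} t \<partial>torus_measure)"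
    using I fin by (simp add: measure_def Int_absorb2)
  also have "\<dots> \<le> (\<integral>t. (\<Sum>k<N. c k powr ?q * (\<bar>f k t\<bar> powr ?q * \<omega> t)) \<partial>torus_measure)"
  proof (rule Bochner_Integration.integral_mono)
    show "integrable torus_measure (\<lambda>t. (L powr ?q * w) * indicator {x..x+l} t)"
      using sets fin by (intro integrable_mult_right integrable_real_indicator) auto
    show "integrable torus_measure (\<lambda>t. \<Sum>k<N. c k powr ?q * (\<bar>f k t\<bar> powr ?q * \<omega> t))"
      by (intro Bochner_Integration.integrable_sum integrable_mult_right torus_integrable f q)
    fix t
    have nn: "0 \<le> c k powr ?q * (\<bar>f k t\<bar> powr ?q * \<omega> t)" for k using nonneg by simp
    show "(L powr ?q * w) * indicator {x..x+l} t \<le> (\<Sum>k<N. c k powr ?q * (\<bar>f k t\<bar> powr ?q * \<omega> t))"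
    proof (cases "t \<in> {x..x+l}")
      case t: True
      then obtain k where k: "k < N" "L \<le> c k * \<bar>f k t\<bar>" using big by blast
      have "L powr ?q * w \<le> (c k * \<bar>f k t\<bar>) powr ?q * \<omega> t"
        using k w t L q by (intro mult_mono powr_mono2) auto
      also have "\<dots> = c k powr ?q * (\<bar>f k t\<bar> powr ?q * \<omega> t)" by (simp add: powr_mult)
      also have "\<dots> \<le> (\<Sum>k<N. c k powr ?q * (\<bar>f k t\<bar> powr ?q * \<omega> t))"
        using k(1) nn by (intro member_le_sum) auto
      finally show ?thesis using t by simp
    qed (simp add: sum_nonneg nn)
  qed
  also have "\<dots> = (\<Sum>k<N. c k powr ?q * (\<integral>t. \<bar>f k t\<bar> powr ?q * \<omega> t \<partial>torus_measure))"
    by (subst Bochner_Integration.integral_sum) (auto intro: integrable_mult_right torus_integrable f q)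
  finally show ?thesis using norm_power_eq_integral[OF p False] by simp
qed

end

section \<open>Translating trigonometric polynomials under a Bernstein inequality\<close>

lemma trig_poly_continuous: "trig_poly n Q \<Longrightarrow> continuous_on UNIV Q"
  using trig_poly_iterated_deriv_bound[of n Q]
  by (metis DERIV_continuous_on funpow_0 has_field_derivative_at_within)

lemma trig_poly_Taylor:
  assumes Q: "trig_poly n Q" and L: "0 < L"
  shows "\<exists>N. \<forall>t. \<bar>Q (t + s) - (\<Sum>k<N. (deriv ^^ k) Q t / fact k * s ^ k)\<bar> < L"
proof -
  obtain M where M: "0 \<le> M" and D: "\<And>k t. ((deriv ^^ k) Q has_real_derivative (deriv ^^ Suc k) Q t) (at t)"
    and bd: "\<And>k t. \<bar>(deriv ^^ k) Q t\<bar> \<le> M * real n ^ k"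
    using trig_poly_iterated_deriv_bound[OF Q] by auto
  have "(\<lambda>k. (real n * \<bar>s\<bar>) ^ k /\<^sub>R fact k) \<longlonglongrightarrow> 0"
    by (rule summable_LIMSEQ_zero[OF summable_exp_generic])
  then have "(\<lambda>k. (real n * \<bar>s\<bar>) ^ k / fact k) \<longlonglongrightarrow> 0"
    by (simp add: divide_inverse_commute)
  then have "(\<lambda>k. M * ((real n * \<bar>s\<bar>) ^ k / fact k)) \<longlonglongrightarrow> M * 0"
    by (rule tendsto_mult_left)
  then have "\<forall>\<^sub>F k in sequentially. M * ((real n * \<bar>s\<bar>) ^ k / fact k) < L"
    using L by (intro order_tendstoD) auto
  then obtain N where N: "M * ((real n * \<bar>s\<bar>) ^ N / fact N) < L"
    using eventually_happens'[OF sequentially_bot] by blast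
  have "\<bar>Q (t + s) - (\<Sum>k<N. (deriv ^^ k) Q t / fact k * s ^ k)\<bar> < L" for t
  proof -
    have "\<forall>m x. DERIV (\<lambda>y. (deriv ^^ m) Q (t + y)) x :> (deriv ^^ Suc m) Q (t + x)"
    proof (intro allI)
      fix m x
      show "DERIV (\<lambda>y. (deriv ^^ m) Q (t + y)) x :> (deriv ^^ Suc m) Q (t + x)"
        using D[of m "x + t"] unfolding DERIV_shift by (simp add: add.commute)
    qed
    from Maclaurin_all_le[OF refl this, of s N]
    obtain u where "Q (t + s) = (\<Sum>k<N. (deriv ^^ k) Q t / fact k * s ^ k) + (deriv ^^ N) Q (t + u) / fact N * s ^ N"
      unfolding funpow_0 add_0_right by blast
    then have "\<bar>Q (t + s) - (\<Sum>k<N. (deriv ^^ k) Q t / fact k * s ^ k)\<bar> = \<bar>(deriv ^^ N) Q (t + u)\<bar> / fact N * \<bar>s\<bar> ^ N"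
      by (simp add: abs_mult power_abs)
    also have "\<dots> \<le> M * real n ^ N / fact N * \<bar>s\<bar> ^ N"
      by (intro mult_right_mono divide_right_mono bd) auto
    finally show ?thesis using N by (simp add: power_mult_distrib)
  qed
  then show ?thesis by blast
qed

text \<open>
If every term of the Taylor expansion of \<open>Q (t - s)\<close> at \<open>t\<close> were smaller than \<open>L / 2 ^ (k + 2)\<close>, their
sum would be at most \<open>L / 2\<close>, and the remainder does not make up the rest. Selecting one term rather
than adding norms is what makes the argument work for all \<open>p > 0\<close>; since \<open>N\<close> does not depend on \<open>t\<close>,
only finitely many derivatives are involved.
\<close>

lemma shift_dichotomy:
  assumes Q: "trig_poly n Q" and L: "0 < L" and s: "0 \<le> s"
  shows "\<exists>N. \<forall>t. L \<le> \<bar>Q (t - s)\<bar> \<longrightarrow> (\<exists>k<N. L \<le> 2 ^ (k + 2) * (s ^ k / fact k) * \<bar>(deriv ^^ k) Q t\<bar>)"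
proof -
  obtain N where N: "\<And>t. \<bar>Q (t + -s) - (\<Sum>k<N. (deriv ^^ k) Q t / fact k * (-s) ^ k)\<bar> < L / 2"
    using trig_poly_Taylor[OF Q, of "L/2" "-s"] L by auto
  have "\<exists>k<N. L \<le> 2 ^ (k + 2) * (s ^ k / fact k) * \<bar>(deriv ^^ k) Q t\<bar>" if t: "L \<le> \<bar>Q (t - s)\<bar>" for t
  proof (rule ccontr)
    assume "\<not> ?thesis"
    then have small: "s ^ k / fact k * \<bar>(deriv ^^ k) Q t\<bar> \<le> L / 4 * (1/2) ^ k" if "k < N" for k
      using that by (force simp: field_simps power_add not_le)
    have "\<bar>\<Sum>k<N. (deriv ^^ k) Q t / fact k * (-s) ^ k\<bar> \<le> (\<Sum>k<N. \<bar>(deriv ^^ k) Q t / fact k * (-s) ^ k\<bar>)"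
      by (rule sum_abs)
    also have "\<dots> \<le> (\<Sum>k<N. L / 4 * (1/2) ^ k)"
      using small s by (intro sum_mono) (auto simp: abs_mult power_abs mult.commute)
    also have "\<dots> = L / 4 * (\<Sum>k<N. (1/2) ^ k)" by (simp add: sum_distrib_left)
    also have "(\<Sum>k<N. (1/2::real) ^ k) \<le> 2"
      by (subst geometric_sum) (auto simp: field_simps)
    finally have "\<bar>\<Sum>k<N. (deriv ^^ k) Q t / fact k * (-s) ^ k\<bar> \<le> L / 2" using L by simp
    moreover have "Q (t + -s) = Q (t - s)" by simp
    ultimately show False using N[of t] t by linarith
  qed
  then show ?thesis by blast
qed

text \<open>
A Bernstein inequality with constant \<open>C\<close> bounds the norm of the \<open>k\<close>-th derivative by \<open>C ^ k\<close> times that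
of \<open>Q\<close>, and the weights from \<open>shift_dichotomy\<close> then sum to an exponential: translating a polynomial by
\<open>s\<close> costs at most a factor of order \<open>exp (4 C s)\<close>, whatever \<open>p\<close> is. The factor 4 instead of 1 and the
geometric series in \<open>2 powr - q\<close> pay for the lack of a triangle inequality.
\<close>

lemma shift_bound:
  assumes w: "continuous_on UNIV \<omega>" "\<And>t. 0 \<le> \<omega> t" and p: "0 < p" and Q: "trig_poly n Q"
    and C: "0 \<le> C"
    and bernstein: "\<And>R. trig_poly n R \<Longrightarrow> weighted_norm p \<omega> (deriv R) \<le> C * weighted_norm p \<omega> R"
    and I: "-pi \<le> x" "x + l \<le> pi" "0 < l" "l \<le> 1"
    and w0: "\<And>t. t \<in> {x..x+l} \<Longrightarrow> w0 \<le> \<omega> t" "0 \<le> w0"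
    and L: "0 < L" "\<And>t. t \<in> {x..x+l} \<Longrightarrow> L \<le> \<bar>Q (t - s)\<bar>" and s: "0 \<le> s"
  shows "L powr norm_exponent p * w0 * l \<le>
     4 powr norm_exponent p / (1 - 2 powr - norm_exponent p) * exp (4 * C * s * norm_exponent p) * norm_power p \<omega> Q"
proof -
  let ?q = "norm_exponent p"
  have q: "0 < ?q" by (rule norm_exponent_pos[OF p])
  have tp: "trig_poly n ((deriv ^^ k) Q)" for k using trig_poly_iterated_deriv_bound[OF Q] by blast
  have it: "weighted_norm p \<omega> ((deriv ^^ k) Q) \<le> C ^ k * weighted_norm p \<omega> Q" for k
  proof (induction k)
    case (Suc k)
    have "weighted_norm p \<omega> ((deriv ^^ Suc k) Q) \<le> C * weighted_norm p \<omega> ((deriv ^^ k) Q)"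
      using bernstein[OF tp[of k]] by simp
    also have "\<dots> \<le> C * (C ^ k * weighted_norm p \<omega> Q)" using C Suc by (intro mult_left_mono)
    finally show ?case by (simp add: mult_ac)
  qed simp
  have np: "norm_power p \<omega> ((deriv ^^ k) Q) \<le> (C ^ k) powr ?q * norm_power p \<omega> Q" for k
    unfolding norm_power_def powr_mult[symmetric]
    using q weighted_norm_nonneg it by (intro powr_mono2) auto
  define c :: "nat \<Rightarrow> real" where "c k = 2 ^ (k + 2) * (s ^ k / fact k)" for k
  obtain N where N: "\<And>t. L \<le> \<bar>Q (t - s)\<bar> \<Longrightarrow> \<exists>k<N. L \<le> c k * \<bar>(deriv ^^ k) Q t\<bar>"
    using shift_dichotomy[OF Q L(1) s] unfolding c_def by blast
  have ck: "c k powr ?q * norm_power p \<omega> ((deriv ^^ k) Q) \<le>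
      (4 powr ?q * exp (4 * C * s * ?q) * norm_power p \<omega> Q) * (2 powr - ?q) ^ k" for k
  proof -
    have "(4 * (C * s)) ^ k / fact k \<le> exp (4 * (C * s))"
      by (rule exp_ge_power_div_fact) (use C s in simp)
    then have "4 * ((4 * (C * s)) ^ k / fact k) * (1/2) ^ k \<le> 4 * exp (4 * (C * s)) * (1/2) ^ k"
      by (intro mult_right_mono mult_left_mono) auto
    moreover have "c k * C ^ k = 4 * ((4 * (C * s)) ^ k / fact k) * (1/2) ^ k"
    proof -
      have "(4 * (C * s)) ^ k * (1/2) ^ k = 2 ^ k * s ^ k * C ^ k"
        unfolding power_mult_distrib[symmetric] by (simp add: mult_ac)
      then show ?thesis unfolding c_def by (simp add: power_add)
    qed
    ultimately have le: "c k * C ^ k \<le> 4 * exp (4 * (C * s)) * (1/2) ^ k" by simp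
    have nn: "0 \<le> norm_power p \<omega> Q" by (simp add: norm_power_def)
    have "c k powr ?q * norm_power p \<omega> ((deriv ^^ k) Q) \<le> c k powr ?q * ((C ^ k) powr ?q * norm_power p \<omega> Q)"
      by (intro mult_left_mono np) auto
    also have "\<dots> = (c k * C ^ k) powr ?q * norm_power p \<omega> Q" by (simp add: powr_mult)
    also have "\<dots> \<le> (4 * exp (4 * (C * s)) * (1/2) ^ k) powr ?q * norm_power p \<omega> Q"
      using q le C s nn by (intro mult_right_mono powr_mono2) (auto simp: c_def)
    also have "(4 * exp (4 * (C * s)) * (1/2) ^ k) powr ?q = 4 powr ?q * exp (4 * C * s * ?q) * (2 powr - ?q) ^ k"
    proof -
      have "((1/2::real) ^ k) powr ?q = (2 powr - ?q) ^ k"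
        by (simp add: powr_powr powr_minus power_one_over powr_realpow[symmetric] powr_divide field_simps)
      then show ?thesis by (simp add: powr_mult exp_powr_real mult_ac)
    qed
    finally show ?thesis by (simp add: mult_ac)
  qed
  have cnt: "continuous_on UNIV ((deriv ^^ k) Q)" for k using tp trig_poly_continuous by blast
  have "L powr ?q * w0 * l \<le> (\<Sum>k<N. c k powr ?q * norm_power p \<omega> ((deriv ^^ k) Q))"
    by (rule norm_power_sum_ge[OF w cnt p _ L(1) I w0]) (use s N L in \<open>auto simp: c_def\<close>)
  also have "\<dots> \<le> (\<Sum>k<N. (4 powr ?q * exp (4 * C * s * ?q) * norm_power p \<omega> Q) * (2 powr - ?q) ^ k)"
    by (intro sum_mono ck)
  also have "\<dots> = (4 powr ?q * exp (4 * C * s * ?q) * norm_power p \<omega> Q) * (\<Sum>k<N. (2 powr - ?q) ^ k)"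
    by (simp add: sum_distrib_left)
  also have "\<dots> \<le> (4 powr ?q * exp (4 * C * s * ?q) * norm_power p \<omega> Q) * (1 / (1 - 2 powr - ?q))"
  proof (rule mult_left_mono)
    have lt: "2 powr - ?q < 1" using q by (simp add: powr_less_one)
    then have "(\<Sum>k<N. (2 powr - ?q) ^ k) = (1 - (2 powr - ?q) ^ N) / (1 - 2 powr - ?q)"
      using q by (simp add: sum_gp_strict)
    also have "\<dots> \<le> 1 / (1 - 2 powr - ?q)" using lt by (intro divide_right_mono) auto
    finally show "(\<Sum>k<N. (2 powr - ?q) ^ k) \<le> 1 / (1 - 2 powr - ?q)" .
  qed (simp add: norm_power_def)
  finally show ?thesis by (simp add: mult_ac)
qed

text \<open>
The weight may vanish on large sets, but it is positive on an interval. A polynomial of norm 0 therefore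
vanishes on an interval, with all its derivatives, and so everywhere by Taylor expansion. This rules out a vanishing
denominator in the quotient of norms.
\<close>

lemma trig_poly_zero_norm:
  assumes w: "continuous_on UNIV \<omega>" "\<And>t. 0 \<le> \<omega> t" and p: "0 < p" and Q: "trig_poly n Q"
    and pos: "\<And>t. 0 < t \<Longrightarrow> t < e \<Longrightarrow> 0 < \<omega> t" and e: "0 < e"
    and zero: "weighted_norm p \<omega> Q = 0"
  shows "Q = (\<lambda>_. 0)"
proof -
  have z: "Q t = 0" if t: "0 < t" "t < min 1 e" for t
  proof (rule ccontr)
    assume "Q t \<noteq> 0"
    have "continuous_on UNIV (\<lambda>u. \<bar>Q u\<bar>)"
      using trig_poly_continuous[OF Q] by (intro continuous_intros)
    then have "((\<lambda>u. \<bar>Q u\<bar>) \<longlongrightarrow> \<bar>Q t\<bar>) (at_right t)" "(\<omega> \<longlongrightarrow> \<omega> t) (at_right t)"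
      using w by (auto simp: continuous_on_def intro: tendsto_within_subset)
    then have "\<forall>\<^sub>F u in at_right t. \<bar>Q t\<bar> / 2 < \<bar>Q u\<bar> \<and> \<omega> t / 2 < \<omega> u"
      using \<open>Q t \<noteq> 0\<close> pos[of t] t by (intro eventually_conj order_tendstoD(1)) auto
    then obtain d where d: "t < d" "\<And>u. t < u \<Longrightarrow> u < d \<Longrightarrow> \<bar>Q t\<bar> / 2 < \<bar>Q u\<bar> \<and> \<omega> t / 2 < \<omega> u"
      unfolding eventually_at_right_field by blast
    \<comment> \<open>The middle third of the interval from \<open>t\<close> to \<open>m\<close> stays inside the torus and the neighbourhood.\<close>
    define m where "m = min 1 d"
    have m: "m \<le> 1" "m \<le> d" "t < m" using d(1) t by (auto simp: m_def)
    define l where "l = (m - t) / 3"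
    have ml: "m = t + 3 * l" unfolding l_def by (simp add: field_simps)
    have l: "0 < l" "l \<le> 1" "t + l + l \<le> pi" "t + l + l < d" "-pi \<le> t + l"
      using ml m t(1) pi_gt3 by linarith+
    have "(\<bar>Q t\<bar> / 2) powr norm_exponent p * (\<omega> t / 2) * l \<le>
        (\<Sum>k<(1::nat). (1::real) powr norm_exponent p * norm_power p \<omega> Q)"
    proof (rule norm_power_sum_ge[OF w _ p, where x = "t + l" and f = "\<lambda>_. Q" and c = "\<lambda>_. 1"])
      show "continuous_on UNIV Q" by (rule trig_poly_continuous[OF Q])
      have near: "\<bar>Q t\<bar> / 2 < \<bar>Q u\<bar> \<and> \<omega> t / 2 < \<omega> u" if "u \<in> {t + l..t + l + l}" for u
        using that l by (intro d(2)) auto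
      then show "\<omega> t / 2 \<le> \<omega> u" if "u \<in> {t + l..t + l + l}" for u using that by force
      show "\<exists>k<(1::nat). \<bar>Q t\<bar> / 2 \<le> 1 * \<bar>Q u\<bar>" if "u \<in> {t + l..t + l + l}" for u
        using near[OF that] by auto
    qed (use l \<open>Q t \<noteq> 0\<close> w(2) in auto)
    also have "\<dots> = 0" using zero norm_exponent_pos[OF p] by (simp add: norm_power_def)
    finally have "(\<bar>Q t\<bar> / 2) powr norm_exponent p * (\<omega> t / 2) * l \<le> 0" .
    moreover have "0 < (\<bar>Q t\<bar> / 2) powr norm_exponent p * (\<omega> t / 2) * l"
      using \<open>Q t \<noteq> 0\<close> pos[of t] t l by (intro mult_pos_pos) auto
    ultimately show False by simp
  qed
  define t0 where "t0 = min 1 e / 2"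
  have t0: "0 < t0" "t0 < min 1 e" using e by (auto simp: t0_def)
  have Dz: "\<forall>t. 0 < t \<and> t < min 1 e \<longrightarrow> (deriv ^^ k) Q t = 0" for k
  proof (induction k)
    case (Suc k)
    show ?case
    proof (intro allI impI)
      fix t assume t: "0 < t \<and> t < min 1 e"
      have "\<forall>\<^sub>F u in nhds t. u \<in> {0<..<min 1 e}"
        using t by (intro eventually_nhds_in_open) auto
      then have "\<forall>\<^sub>F u in nhds t. (deriv ^^ k) Q u = 0" by eventually_elim (use Suc in auto)
      then have "deriv ((deriv ^^ k) Q) t = deriv (\<lambda>_. 0) t" by (rule deriv_cong_ev) simp
      then show "(deriv ^^ Suc k) Q t = 0" by simp
    qed
  qed (use z in auto)
  show ?thesis
  proof
    fix t
    show "Q t = 0"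
    proof (rule ccontr)
      assume "Q t \<noteq> 0"
      then obtain N where "\<And>u. \<bar>Q (u + (t - t0)) - (\<Sum>k<N. (deriv ^^ k) Q u / fact k * (t - t0) ^ k)\<bar> < \<bar>Q t\<bar>"
        using trig_poly_Taylor[OF Q, of "\<bar>Q t\<bar>" "t - t0"] by auto
      from this[of t0] show False using Dz t0 by simp
    qed
  qed
qed

section \<open>A trigonometric polynomial that is small outside one arc\<close>

text \<open>
The argument of the Chebyshev polynomial maps the arc between \<open>b\<close> and \<open>2 pi\<close> onto \<open>{-1..1}\<close> and the
complementary arc between 0 and \<open>b\<close> into \<open>{1..}\<close>. The result is the extremal polynomial in the Remez
inequality for an arc of length \<open>b\<close>.
\<close>

definition arc_cheb :: "nat \<Rightarrow> real \<Rightarrow> real \<Rightarrow> real" where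
  "arc_cheb n b t = cheb n (2 * (1 + cos (t - b / 2)) / (1 + cos (b / 2)) - 1)"

lemma trig_poly_arc_cheb: "trig_poly n (arc_cheb n b)"
proof -
  have "arc_cheb n b = (\<lambda>t. cheb n ((2 / (1 + cos (b/2))) * cos (t - b/2) + (2 / (1 + cos (b/2)) - 1)))"
    unfolding arc_cheb_def by (simp add: add_divide_distrib algebra_simps)
  then show ?thesis using trig_poly_cheb by metis
qed

text \<open>
In this form the sign and the size of the deviation of the argument from 1 can be read off, by
\<open>cos (x - y) - cos (x + y) = 2 sin x sin y\<close>.
\<close>

lemma arc_argument:
  fixes b t :: real
  assumes "0 < b" "b \<le> 1"
  shows "2 * (1 + cos (t - b / 2)) / (1 + cos (b / 2)) - 1 =
    1 + 4 * (sin (t / 2) * sin ((b - t) / 2)) / (1 + cos (b / 2))" "0 \<le> cos (b / 2)"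
proof -
  show c: "0 \<le> cos (b / 2)" using assms pi_gt3 by (intro cos_ge_zero) linarith+
  have e: "t / 2 - (b - t) / 2 = t - b / 2" "t / 2 + (b - t) / 2 = b / 2" by (simp_all add: field_simps)
  have "cos (x - y) - cos (x + y) = 2 * (sin x * sin y)" for x y :: real
    by (simp add: cos_add cos_diff)
  from this[of "t / 2" "(b - t) / 2"]
  have "cos (t - b / 2) - cos (b / 2) = 2 * (sin (t / 2) * sin ((b - t) / 2))" unfolding e .
  then show "2 * (1 + cos (t - b / 2)) / (1 + cos (b / 2)) - 1 =
    1 + 4 * (sin (t / 2) * sin ((b - t) / 2)) / (1 + cos (b / 2))"
    using c by (simp add: field_simps)
qed

lemma arc_cheb_outside:
  assumes b: "0 < b" "b \<le> 1" and t: "t \<in> {-pi..pi}" "t \<notin> {0<..<b}"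
  shows "\<bar>arc_cheb n b t\<bar> \<le> 1"
proof -
  define X where "X = 2 * (1 + cos (t - b / 2)) / (1 + cos (b / 2)) - 1"
  have "sin (t / 2) * sin ((b - t) / 2) \<le> 0"
  proof (cases "t \<le> 0")
    case True
    then have "0 \<le> sin (- (t / 2))" "0 \<le> sin ((b - t) / 2)"
      using t b pi_gt3 by (intro sin_ge_zero; simp)+
    then show ?thesis by (simp add: mult_nonpos_nonneg)
  next
    case False
    then have "0 \<le> sin (t / 2)" "0 \<le> sin (- ((b - t) / 2))"
      using t b pi_gt3 by (intro sin_ge_zero; simp add: field_simps)+
    then show ?thesis by (simp add: mult_nonneg_nonpos)
  qed
  then have "X \<le> 1" unfolding X_def arc_argument(1)[OF b]
    using arc_argument(2)[OF b] by (simp add: divide_nonpos_pos)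
  moreover have "-1 \<le> X"
  proof -
    have "0 \<le> 1 + cos (t - b / 2)" using cos_ge_minus_one[of "t - b/2"] by linarith
    then have "0 \<le> 2 * (1 + cos (t - b / 2)) / (1 + cos (b / 2))"
      using arc_argument(2)[OF b] by (intro divide_nonneg_nonneg) auto
    then show ?thesis unfolding X_def by linarith
  qed
  ultimately have "X = cos (arccos X)" by simp
  then have "cheb n X = cos (real n * arccos X)" by (metis cheb_cos)
  then show ?thesis unfolding arc_cheb_def X_def[symmetric] by simp
qed

lemma sin_ge_half: assumes "0 \<le> x" "x \<le> (1::real)" shows "x / 2 \<le> sin x"
proof -
  have "\<bar>sin x - (\<Sum>m<3. sin_coeff m * x ^ m)\<bar> \<le> inverse (fact 3) * \<bar>x\<bar> ^ 3"
    by (rule Maclaurin_sin_bound)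
  moreover have "(\<Sum>m<3. sin_coeff m * x ^ m) = x"
    by (simp add: sin_coeff_def numeral_eq_Suc)
  moreover have "inverse (fact 3) * \<bar>x\<bar> ^ 3 \<le> x / 2"
  proof -
    have "x ^ 3 \<le> x ^ 1" using assms by (intro power_decreasing) auto
    then show ?thesis using assms by (simp add: fact_numeral)
  qed
  ultimately have "\<bar>sin x - x\<bar> \<le> x / 2" by linarith
  then have "- (sin x - x) \<le> x / 2" by (rule order_trans[OF abs_ge_minus_self])
  then show ?thesis by argo
qed

text \<open>
The number \<open>y\<close> is the inverse hyperbolic cosine of the argument, which exceeds 1 by a quantity
comparable to \<open>t * (b - t)\<close>. Hence \<open>y\<close> is comparable to \<open>sqrt (t * (b - t))\<close>: the growth of the
polynomial inside the arc sets in like a square root, with infinite slope, at its endpoint \<open>b\<close>.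
\<close>

lemma arc_cheb_inside:
  assumes b: "0 < b" "b \<le> 1" and t: "0 < t" "t < b"
  obtains y where "0 \<le> y" "arc_cheb n b t = cosh (real n * y)" "y\<^sup>2 \<le> 8 * (t * (b - t))"
    "y \<le> 1 \<Longrightarrow> t * (b - t) \<le> 16 * y\<^sup>2"
proof -
  define S where "S = sin (t / 2) * sin ((b - t) / 2)"
  define c where "c = cos (b / 2)"
  have c: "0 \<le> c" "c \<le> 1" using arc_argument(2)[OF b] by (auto simp: c_def)
  have S1: "S \<le> (t / 2) * ((b - t) / 2)"
    unfolding S_def using t b pi_gt3 by (intro mult_mono sin_x_le_x sin_ge_zero) auto
  have S0: "(t / 4) * ((b - t) / 4) \<le> S"
    unfolding S_def using t b sin_ge_half[of "t/2"] sin_ge_half[of "(b-t)/2"] by (intro mult_mono) auto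
  have "0 \<le> (t / 4) * ((b - t) / 4)" using t by simp
  with S0 have Sn: "0 \<le> S" by linarith
  define X where "X = 1 + 4 * S / (1 + c)"
  have X: "arc_cheb n b t = cheb n X"
    unfolding arc_cheb_def X_def S_def c_def arc_argument(1)[OF b] ..
  have "4 * S / (1 + c) \<le> 4 * S / 1" using c Sn by (intro divide_left_mono) auto
  then have X1: "X - 1 \<le> t * (b - t)" using S1 unfolding X_def by simp
  have "4 * S / 2 \<le> 4 * S / (1 + c)" using c Sn by (intro divide_left_mono) auto
  then have X0: "t * (b - t) \<le> 8 * (X - 1)" using S0 unfolding X_def by simp
  have X2: "1 \<le> X" unfolding X_def using c Sn by simp
  define y where "y = arcosh X"
  have y: "0 \<le> y" "cosh y = X" using X2 by (auto simp: y_def)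
  show ?thesis
  proof (rule that[of y])
    show "arc_cheb n b t = cosh (real n * y)" unfolding X using y cheb_cosh by metis
    show "y\<^sup>2 \<le> 8 * (t * (b - t))" using cosh_lower[OF y(1)] X1 unfolding y(2) by argo
    show "t * (b - t) \<le> 16 * y\<^sup>2" if "y \<le> 1" using cosh_upper[OF y(1) that] X0 unfolding y(2) by argo
  qed (use y in auto)
qed

lemma arc_cheb_upper:
  assumes b: "0 < b" "b \<le> 1" and t: "0 < t" "t < b" and d: "0 \<le> d" "8 * (t * (b - t)) \<le> d\<^sup>2"
  shows "\<bar>arc_cheb n b t\<bar> \<le> exp (real n * d)"
proof -
  obtain y where y: "0 \<le> y" "arc_cheb n b t = cosh (real n * y)" "y\<^sup>2 \<le> 8 * (t * (b - t))"
    using arc_cheb_inside[OF b t, of n] by metis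
  have "y \<le> d" using y(3) d by (meson order_trans power2_le_imp_le)
  have "cosh (real n * y) \<le> exp (real n * y)"
  proof -
    have "exp (- (real n * y)) \<le> exp (real n * y)" using y(1) by simp
    then show ?thesis by (simp add: cosh_field_def)
  qed
  also have "\<dots> \<le> exp (real n * d)" using \<open>y \<le> d\<close> by (simp add: mult_left_mono)
  finally show ?thesis using y(2) cosh_real_nonneg[of "real n * y"] by simp
qed

lemma arc_cheb_lower:
  assumes b: "0 < b" "b \<le> 1" and t: "0 < t" "t < b" and d: "0 \<le> d" "d \<le> 1" "16 * d\<^sup>2 \<le> t * (b - t)"
  shows "exp (real n * d) / 2 \<le> \<bar>arc_cheb n b t\<bar>"
proof -
  obtain y where y: "0 \<le> y" "arc_cheb n b t = cosh (real n * y)" "y \<le> 1 \<Longrightarrow> t * (b - t) \<le> 16 * y\<^sup>2"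
    using arc_cheb_inside[OF b t, of n] by metis
  have "d \<le> y"
  proof (cases "y \<le> 1")
    case True
    then have "d\<^sup>2 \<le> y\<^sup>2" using y(3) d(3) by linarith
    then show ?thesis using y(1) by (rule power2_le_imp_le)
  qed (use d in linarith)
  have "exp (real n * d) / 2 \<le> exp (real n * y) / 2" using \<open>d \<le> y\<close> by (simp add: mult_left_mono)
  also have "\<dots> \<le> cosh (real n * y)" by (simp add: cosh_field_def field_simps)
  finally show ?thesis using y(2) by simp
qed

section \<open>Refuting a Bernstein inequality at one scale\<close>

text \<open>
Write \<open>x = n \<beta>\<close>. The polynomial \<open>arc_cheb n \<beta>\<close> is tested against \<open>shift_bound\<close> on the interval of length
\<open>\<sigma> \<beta>\<close> that starts at \<open>(1 + \<sigma>) \<beta>\<close>. On the scale \<open>x\<close> its norm is governed by the part of the arc where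
\<open>t > (1 - \<sigma>) \<beta>\<close>, because for smaller \<open>t\<close> the weight is at most \<open>exp (- 2 q x)\<close> and kills the polynomial;
on that part the polynomial is at most \<open>exp (x sqrt (8 \<sigma>))\<close>. The shift by \<open>\<eta> \<beta>\<close> moves the test interval
into the arc, where the polynomial is at least \<open>exp (x sqrt (\<eta> / 64)) / 2\<close>, while a Bernstein inequality
would allow a cost of only \<open>exp (4 C \<eta> x)\<close>. A square root of \<open>\<eta>\<close> beats a multiple of \<open>\<eta>\<close> when \<open>\<eta>\<close> is small.

The parameters are scaled by the exponent \<open>a = sqrt (\<eta> / 64)\<close> that is gained: \<open>\<sigma> = a\<^sup>2 / 128\<close> makes
\<open>sqrt (8 \<sigma>) = a / 4\<close>, the choice \<open>a = 1 / (1024 C)\<close> makes \<open>4 C \<eta> = a / 4\<close>, and the weight on the test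
interval is allowed to lose another \<open>a / 4\<close>. One quarter of the gain remains, and the last hypothesis says
that it exceeds all constants and the length of the interval.
\<close>

lemma bernstein_violation:
  fixes C a q \<beta> :: real and p :: ennreal
  defines "q \<equiv> norm_exponent p" and "a \<equiv> 1 / (1024 * C)"
  defines "\<sigma> \<equiv> a\<^sup>2 / 128" and "K \<equiv> 4 powr norm_exponent p / (1 - 2 powr - norm_exponent p)"
  assumes w: "continuous_on UNIV \<omega>" "\<And>t. 0 \<le> \<omega> t" and p: "0 < p" and C: "1 \<le> C"
    and \<beta>: "0 < \<beta>" "\<beta> \<le> 1 / 2" "2 * \<beta> < \<epsilon>" and mono: "mono_on {0<..<\<epsilon>} \<omega>"
    and W: "\<And>t. t \<in> {-pi..pi} \<Longrightarrow> \<omega> t \<le> W"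
    and left: "\<omega> ((1 - \<sigma>) * \<beta>) \<le> exp (- (2 * q * (real n * \<beta>)))"
    and right: "exp (- (q * a / 4 * (real n * \<beta>))) \<le> \<omega> ((1 + \<sigma>) * \<beta>)"
    and big: "K * (2 * pi * (1 + W)) * 2 powr q < exp (q * a / 4 * (real n * \<beta>)) * (\<sigma> * \<beta>)"
  shows "\<exists>Q. trig_poly n Q \<and> C * real n * weighted_norm p \<omega> Q < weighted_norm p \<omega> (deriv Q)"
proof (rule ccontr)
  assume "\<not> ?thesis"
  then have bern: "weighted_norm p \<omega> (deriv R) \<le> C * real n * weighted_norm p \<omega> R" if "trig_poly n R" for R
    using that by (meson not_le)
  have q: "0 < q" unfolding q_def by (rule norm_exponent_pos[OF p])
  have a: "0 < a" "a \<le> 1 / 1024" "C * a = 1 / 1024" using C by (auto simp: a_def field_simps)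
  define \<eta> where "\<eta> = 64 * a\<^sup>2"
  have "a * a \<le> (1/1024) * (1/1024)" using a by (intro mult_mono) auto
  then have \<sigma>: "0 < \<sigma>" "\<sigma> \<le> 1/4" "0 < \<eta>" "\<eta> \<le> 1/2" "4 * \<sigma> \<le> \<eta>"
    using a by (auto simp: \<sigma>_def \<eta>_def power2_eq_square)
  define N where "N = norm_power p \<omega> (arc_cheb n \<beta>)"
  define E where "E = exp (q * a / 4 * (real n * \<beta>))"
  have x0: "0 \<le> real n * \<beta>" using \<beta> by simp
  have E1: "1 \<le> E" unfolding E_def using q a x0 by simp
  have "0 \<le> \<omega> 0" by (rule w)
  then have W0: "0 \<le> W" using W[of 0] by simp
  have b1: "\<beta> \<le> 1" using \<beta> by simp
  have upper: "N \<le> 2 * pi * ((1 + W) * E)"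
    unfolding N_def
  proof (rule norm_power_le[OF w trig_poly_continuous[OF trig_poly_arc_cheb] p])
    fix t assume t: "t \<in> {-pi..pi}"
    let ?T = "\<bar>arc_cheb n \<beta> t\<bar> powr norm_exponent p"
    have cut: "?T * \<omega> t \<le> (1 + W) * E" if "?T \<le> E"
    proof -
      have "?T * \<omega> t \<le> E * W" using that W[OF t] w E1 by (intro mult_mono) auto
      also have "\<dots> \<le> (1 + W) * E" using E1 by (simp add: algebra_simps)
      finally show ?thesis .
    qed
    consider "t \<notin> {0<..<\<beta>}" | "0 < t" "t \<le> (1 - \<sigma>) * \<beta>" | "(1 - \<sigma>) * \<beta> < t" "0 < t" "t < \<beta>" by force
    then show "?T * \<omega> t \<le> (1 + W) * E"
    proof cases
      case 1
      then have "?T \<le> 1 powr norm_exponent p"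
        using arc_cheb_outside[OF \<beta>(1) b1 t] q by (intro powr_mono2) (auto simp: q_def)
      then show ?thesis using E1 by (intro cut) simp
    next
      case 2
      have s\<beta>: "0 < \<sigma> * \<beta>" using \<sigma> \<beta> by simp
      then have lt: "t < \<beta>" "(1 - \<sigma>) * \<beta> < \<epsilon>" using 2 \<beta> by (auto simp: algebra_simps)
      have "4 * (t * (\<beta> - t)) = \<beta>\<^sup>2 - (\<beta> - 2 * t)\<^sup>2" by (simp add: power2_eq_square algebra_simps)
      then have "8 * (t * (\<beta> - t)) = 2 * \<beta>\<^sup>2 - 2 * (\<beta> - 2 * t)\<^sup>2" by argo
      also have "\<dots> \<le> (2 * \<beta>)\<^sup>2"
        using zero_le_power2[of "\<beta> - 2 * t"] zero_le_power2[of \<beta>] unfolding power_mult_distrib by simp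
      finally have "8 * (t * (\<beta> - t)) \<le> (2 * \<beta>)\<^sup>2" .
      then have "\<bar>arc_cheb n \<beta> t\<bar> \<le> exp (real n * (2 * \<beta>))"
        using 2 lt \<beta> by (intro arc_cheb_upper b1) auto
      then have "?T \<le> exp (real n * (2 * \<beta>)) powr q" using q by (auto simp: q_def intro: powr_mono2)
      also have "\<dots> = exp (2 * q * (real n * \<beta>))" by (simp add: exp_powr_real mult_ac)
      finally have T: "?T \<le> exp (2 * q * (real n * \<beta>))" .
      have "\<omega> t \<le> \<omega> ((1 - \<sigma>) * \<beta>)" using 2 lt \<sigma> \<beta> by (intro mono_onD[OF mono]) auto
      with left have "\<omega> t \<le> exp (- (2 * q * (real n * \<beta>)))" by linarith
      with T have "?T * \<omega> t \<le> exp (2 * q * (real n * \<beta>)) * exp (- (2 * q * (real n * \<beta>)))"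
        using w by (intro mult_mono) auto
      also have "\<dots> = 1" by (simp flip: exp_add)
      also have "1 \<le> (1 + W) * E" using mult_mono[of 1 "1 + W" 1 E] W0 E1 by simp
      finally show ?thesis .
    next
      case 3
      have "t * (\<beta> - t) \<le> \<beta> * (\<sigma> * \<beta>)" using 3 \<beta> by (intro mult_mono) (auto simp: algebra_simps)
      then have "8 * (t * (\<beta> - t)) \<le> (a / 4 * \<beta>)\<^sup>2"
        by (simp add: \<sigma>_def power2_eq_square field_simps)
      then have "\<bar>arc_cheb n \<beta> t\<bar> \<le> exp (real n * (a / 4 * \<beta>))"
        using 3 a \<beta> by (intro arc_cheb_upper b1) auto
      then have "?T \<le> exp (real n * (a / 4 * \<beta>)) powr q" using q by (auto simp: q_def intro: powr_mono2)
      also have "\<dots> = E" by (simp add: E_def exp_powr_real mult_ac)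
      finally show ?thesis by (rule cut)
    qed
  qed
  define L where "L = exp (real n * (a * \<beta>)) / 2"
  have lower: "L powr norm_exponent p * \<omega> ((1 + \<sigma>) * \<beta>) * (\<sigma> * \<beta>) \<le>
      K * exp (4 * (C * real n) * (\<eta> * \<beta>) * norm_exponent p) * N"
    unfolding N_def K_def
  proof (rule shift_bound[OF w p trig_poly_arc_cheb _ bern, where x = "(1 + \<sigma>) * \<beta>"])
    have s\<beta>: "0 < \<sigma> * \<beta>" "\<sigma> * \<beta> \<le> 1/4 * \<beta>" "\<eta> * \<beta> \<le> 1/2 * \<beta>" "4 * (\<sigma> * \<beta>) \<le> \<eta> * \<beta>"
      using \<sigma> \<beta> by (simp_all add: mult_right_mono)
    have ex: "(1 + \<sigma>) * \<beta> = \<beta> + \<sigma> * \<beta>" by (simp add: algebra_simps)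
    show "- pi \<le> (1 + \<sigma>) * \<beta>" "(1 + \<sigma>) * \<beta> + \<sigma> * \<beta> \<le> pi" "0 < \<sigma> * \<beta>" "\<sigma> * \<beta> \<le> 1"
      using s\<beta> \<beta> pi_gt3 unfolding ex by linarith+
    show "\<omega> ((1 + \<sigma>) * \<beta>) \<le> \<omega> t" if "t \<in> {(1 + \<sigma>) * \<beta>..(1 + \<sigma>) * \<beta> + \<sigma> * \<beta>}" for t
    proof (rule mono_onD[OF mono])
      have "\<beta> + \<sigma> * \<beta> \<le> t" "t \<le> \<beta> + \<sigma> * \<beta> + \<sigma> * \<beta>" using that unfolding ex by auto
      moreover from this have "0 < \<beta> + \<sigma> * \<beta>" "\<beta> + \<sigma> * \<beta> < \<epsilon>" "0 < t" "t < \<epsilon>"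
        using s\<beta> \<beta> by linarith+
      ultimately show "(1 + \<sigma>) * \<beta> \<in> {0<..<\<epsilon>}" "t \<in> {0<..<\<epsilon>}" "(1 + \<sigma>) * \<beta> \<le> t"
        unfolding ex by simp_all
    qed
    show "L \<le> \<bar>arc_cheb n \<beta> (t - \<eta> * \<beta>)\<bar>" if "t \<in> {(1 + \<sigma>) * \<beta>..(1 + \<sigma>) * \<beta> + \<sigma> * \<beta>}" for t
    proof -
      define u where "u = t - \<eta> * \<beta>"
      have "\<beta> + \<sigma> * \<beta> \<le> t" "t \<le> \<beta> + \<sigma> * \<beta> + \<sigma> * \<beta>" using that unfolding ex by auto
      moreover have "t = u + \<eta> * \<beta>" by (simp add: u_def)
      ultimately have "\<beta> \<le> 2 * u" "\<eta> * \<beta> + 2 * u \<le> 2 * \<beta>" using s\<beta> by linarith+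
      then have u: "\<beta> / 2 \<le> u" "\<eta> * \<beta> / 2 \<le> \<beta> - u" by auto
      have "\<beta> / 2 * (\<eta> * \<beta> / 2) \<le> u * (\<beta> - u)" using u \<sigma> \<beta> by (intro mult_mono) auto
      moreover have "\<beta> / 2 * (\<eta> * \<beta> / 2) = 16 * (a * \<beta>)\<^sup>2" by (simp add: \<eta>_def power2_eq_square)
      moreover have "a * \<beta> \<le> 1 * 1" using a \<beta> by (intro mult_mono) auto
      moreover have "0 < \<eta> * \<beta>" using \<sigma> \<beta> by simp
      ultimately show ?thesis unfolding L_def u_def[symmetric]
        using a \<beta> u by (intro arc_cheb_lower b1) auto
    qed
  qed (use C w \<sigma> \<beta> in \<open>auto simp: L_def\<close>)
  have "2 powr - q < 1" using q by (simp add: powr_less_one)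
  then have K0: "0 \<le> K" unfolding K_def q_def[symmetric] by simp
  have ce: "4 * (C * real n) * (\<eta> * \<beta>) * q = q * a / 4 * (real n * \<beta>)"
  proof -
    have "4 * (C * real n) * (\<eta> * \<beta>) * q = 256 * (C * a) * (a * q * (real n * \<beta>))"
      by (simp add: \<eta>_def power2_eq_square)
    then show ?thesis unfolding a(3) by simp
  qed
  \<comment> \<open>In powers of \<open>E = exp (q a x / 4)\<close>: the gain is \<open>E ^ 4\<close>, and the weight on the test interval, the
    shift and the norm of the polynomial cost one factor \<open>E\<close> each.\<close>
  have "L powr q = E ^ 4 / 2 powr q"
    by (simp add: L_def E_def powr_divide exp_powr_real mult_ac flip: exp_of_nat_mult)
  moreover have "1 / E \<le> \<omega> ((1 + \<sigma>) * \<beta>)" using right by (simp add: E_def exp_minus field_simps)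
  ultimately have "E ^ 4 / 2 powr q * (1 / E) * (\<sigma> * \<beta>) \<le> L powr q * \<omega> ((1 + \<sigma>) * \<beta>) * (\<sigma> * \<beta>)"
    using E1 \<sigma> \<beta> by (intro mult_right_mono mult_mono) auto
  also have "\<dots> \<le> K * E * N" using lower unfolding q_def[symmetric] ce E_def[symmetric] .
  also have "\<dots> \<le> K * E * (2 * pi * ((1 + W) * E))" using upper K0 E1 by (intro mult_left_mono) auto
  finally have "E ^ 3 * (\<sigma> * \<beta>) \<le> (K * (2 * pi * (1 + W)) * 2 powr q) * E ^ 2"
    using E1 by (simp add: field_simps power2_eq_square eval_nat_numeral)
  also have "\<dots> < (E * (\<sigma> * \<beta>)) * E ^ 2" using big E1 unfolding E_def[symmetric]
    by (intro mult_strict_right_mono) auto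
  finally show False by (simp add: eval_nat_numeral mult_ac)
qed

section \<open>Flat weights and the failure of Bernstein inequalities\<close>

text \<open>
Iterated halving gives \<open>v (t / 2 ^ k) \<ge> 2 ^ k\<close>, hence growth at least like \<open>1 / t\<close>. This is what makes
\<open>exp (v t)\<close> dominate the factor \<open>1 / t\<close> that comes from the length of the test interval.
\<close>

lemma reciprocal_growth:
  fixes v :: "real \<Rightarrow> real"
  assumes d: "0 < d" and double: "\<And>t. 0 < t \<Longrightarrow> t < d \<Longrightarrow> 2 * v t \<le> v (t / 2)"
    and one: "\<And>t. 0 < t \<Longrightarrow> t < d \<Longrightarrow> 1 \<le> v t" and t: "0 < t" "t < d"
  shows "d / 2 \<le> t * v t"
proof -
  have "d / 2 ^ k \<le> t \<Longrightarrow> t < d \<Longrightarrow> d / 2 \<le> t * v t" for k t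
  proof (induction k arbitrary: t)
    case (Suc k)
    have "0 < d / 2 ^ Suc k" using d by simp
    then have t0: "0 < t" using Suc.prems by linarith
    show ?case
    proof (cases "d / 2 \<le> t")
      case True
      have "d / 2 * 1 \<le> t * v t" using True one[OF t0 Suc.prems(2)] t0 by (intro mult_mono) auto
      then show ?thesis by simp
    next
      case False
      then have "d / 2 \<le> (2 * t) * v (2 * t)"
        using Suc.prems by (intro Suc.IH) (auto simp: field_simps)
      also have "\<dots> = t * (2 * v (2 * t))" by simp
      also have "\<dots> \<le> t * v t" using double[of "2 * t"] t0 False by (intro mult_left_mono) auto
      finally show ?thesis .
    qed
  qed simp
  moreover obtain k where "d / t < 2 ^ k" using real_arch_pow[of 2 "d / t"] by auto
  then have "d / 2 ^ k \<le> t" using t by (simp add: field_simps)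
  ultimately show ?thesis using t by blast
qed

text \<open>
With \<open>v = - ln \<omega>\<close>, the scale \<open>\<beta>\<close> is chosen by \<open>v \<beta> = n \<beta>\<close>: there the decay of the weight and the growth
rate of polynomials of degree \<open>n\<close> on an arc of length \<open>\<beta>\<close> balance. By the intermediate
value theorem this equation has a solution below any prescribed bound once \<open>n\<close> is large. By the flatness of the weight, a change of
\<open>\<beta>\<close> by a fixed factor \<open>1 - \<sigma>\<close> or \<open>1 + \<sigma>\<close>, however close to 1, multiplies or divides \<open>v\<close> by
as large a constant as desired, so the weight acts like the indicator function of the complement of
the arc.
\<close>

lemma bernstein_fails_eventually:
  fixes \<omega> :: "real \<Rightarrow> real" and \<epsilon> C :: real and p :: ennreal
  assumes w: "continuous_on UNIV \<omega>" "\<And>t. 0 \<le> \<omega> t"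
    and \<epsilon>: "0 < \<epsilon>" and mono: "mono_on {0<..<\<epsilon>} \<omega>" and zero: "\<omega> 0 = 0"
    and pos: "\<forall>\<^sub>F t in at 0. 0 < \<omega> t"
    and flat: "\<And>r. 0 < r \<Longrightarrow> r < 1 \<Longrightarrow>
           filterlim (\<lambda>t. ln (\<omega> (r * t)) / ln (\<omega> t)) at_top (at 0)"
    and p: "0 < p" and C: "1 \<le> C"
  shows "\<exists>N. \<forall>n\<ge>N. \<exists>Q. trig_poly n Q \<and> C * real n * weighted_norm p \<omega> Q < weighted_norm p \<omega> (deriv Q)"
proof -
  define q where "q = norm_exponent p"
  define a where "a = 1 / (1024 * C)"
  define \<sigma> where "\<sigma> = a\<^sup>2 / 128"
  define K where "K = 4 powr q / (1 - 2 powr - q)"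
  define v where "v t = - ln (\<omega> t)" for t
  have q: "0 < q" unfolding q_def by (rule norm_exponent_pos[OF p])
  have a: "0 < a" "a \<le> 1 / 1024" using C by (auto simp: a_def field_simps)
  have "a * a \<le> (1/1024) * (1/1024)" using a by (intro mult_mono) auto
  then have \<sigma>: "0 < \<sigma>" "\<sigma> < 1" using a by (auto simp: \<sigma>_def power2_eq_square)
  have right: "\<forall>\<^sub>F t in at_right 0. P t" if "\<forall>\<^sub>F t in at 0. P t" for P :: "real \<Rightarrow> bool"
    using that by (simp add: eventually_at_split)
  have "(\<omega> \<longlongrightarrow> \<omega> 0) (at 0)" using w(1) unfolding continuous_on_def by blast
  then have "(\<omega> \<longlongrightarrow> 0) (at 0)" unfolding zero .
  then have small: "\<forall>\<^sub>F t in at_right 0. \<omega> t < exp (-1)"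
    by (intro right order_tendstoD(2)[of \<omega> 0]) simp_all
  have ev: "\<forall>\<^sub>F t in at_right 0. A * v t \<le> v (r * t)" if r: "0 < r" "r < 1" for A r
  proof -
    have "\<forall>\<^sub>F t in at_right 0. A \<le> ln (\<omega> (r * t)) / ln (\<omega> t)"
      using flat[OF r] by (intro right) (simp add: filterlim_at_top)
    then show ?thesis using small right[OF pos]
    proof eventually_elim
      case (elim t)
      then have "ln (\<omega> t) < ln (exp (-1))" by (subst ln_less_cancel_iff) auto
      then have "ln (\<omega> t) < 0" by simp
      with elim(1) show ?case by (simp add: v_def field_simps)
    qed
  qed
  \<comment> \<open>Being below \<open>exp (-1)\<close> rather than below 1 gives \<open>1 \<le> v t\<close>.\<close>
  have "\<forall>\<^sub>F t in at_right 0. 0 < \<omega> t \<and> \<omega> t < exp (-1) \<and> 2 * v t \<le> v (1/2 * t) \<and>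
      2 * q * v t \<le> v ((1 - \<sigma>) * t) \<and> 4 / (q * a) * v t \<le> v (1 / (1 + \<sigma>) * t)"
  proof (intro eventually_conj small right[OF pos])
    show "\<forall>\<^sub>F t in at_right 0. 2 * v t \<le> v (1/2 * t)" by (rule ev) auto
    show "\<forall>\<^sub>F t in at_right 0. 2 * q * v t \<le> v ((1 - \<sigma>) * t)" using \<sigma> by (intro ev) auto
    show "\<forall>\<^sub>F t in at_right 0. 4 / (q * a) * v t \<le> v (1 / (1 + \<sigma>) * t)" using \<sigma> by (intro ev) auto
  qed
  then obtain d0 where d0: "0 < d0" and D0: "\<And>t. 0 < t \<Longrightarrow> t < d0 \<Longrightarrow> 0 < \<omega> t \<and> \<omega> t < exp (-1) \<and> 2 * v t \<le> v (1/2 * t) \<and>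
      2 * q * v t \<le> v ((1 - \<sigma>) * t) \<and> 4 / (q * a) * v t \<le> v (1 / (1 + \<sigma>) * t)"
    unfolding eventually_at_right_field by blast
  have v1: "1 \<le> v t" if "0 < t" "t < d0" for t
  proof -
    have "ln (\<omega> t) < ln (exp (-1))" using D0[OF that] by (subst ln_less_cancel_iff) auto
    then show ?thesis by (simp add: v_def)
  qed
  have growth: "d0 / 2 \<le> t * v t" if "0 < t" "t < d0" for t
  proof (rule reciprocal_growth[OF d0 _ v1 that])
    show "2 * v u \<le> v (u / 2)" if "0 < u" "u < d0" for u using D0[OF that] by simp
  qed
  have "continuous_on {-pi..pi} \<omega>" using w(1) by (rule continuous_on_subset) simp
  from continuous_attains_sup[OF _ _ this]
  obtain W where W: "\<And>t. t \<in> {-pi..pi} \<Longrightarrow> \<omega> t \<le> W" by force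
  define B where "B = K * (2 * pi * (1 + W)) * 2 powr q"
  define c where "c = q * a / 4 * (d0 / 2)"
  have c: "0 < c" using q a d0 by (simp add: c_def)
  define d where "d = Min {d0 / 2, 1 / 2, \<epsilon> / 3, \<sigma> * c\<^sup>2 / 2 / (\<bar>B\<bar> + 1)}"
  have "0 < \<sigma> * c\<^sup>2 / 2 / (\<bar>B\<bar> + 1)" using \<sigma> c by (intro divide_pos_pos mult_pos_pos) auto
  then have d: "0 < d" using \<epsilon> d0 unfolding d_def by (subst Min_gr_iff) auto
  have "d \<le> \<epsilon> / 3" unfolding d_def by (rule Min_le) auto
  then have d\<epsilon>: "2 * d < \<epsilon>" using \<epsilon> by simp
  have dle: "d \<le> d0 / 2" "d \<le> 1 / 2" "d \<le> \<sigma> * c\<^sup>2 / 2 / (\<bar>B\<bar> + 1)"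
    unfolding d_def by (rule Min_le; simp)+
  note d = d dle d\<epsilon>
  have big: "B < exp (q * a / 4 * v t) * (\<sigma> * t)" if t: "0 < t" "t < d" for t
  proof -
    have "c / t \<le> q * a / 4 * v t"
    proof -
      have "q * a / 4 * (d0 / 2) \<le> q * a / 4 * (t * v t)"
        using growth[of t] t d d0 q a by (intro mult_left_mono) auto
      then show ?thesis using t by (simp add: c_def field_simps)
    qed
    \<comment> \<open>A quadratic lower bound of \<open>exp\<close> beats the factor \<open>t\<close>.\<close>
    have "(c / t) ^ 2 / fact 2 \<le> exp (c / t)" by (rule exp_ge_power_div_fact) (use c t in simp)
    also have "\<dots> \<le> exp (q * a / 4 * v t)" using \<open>c / t \<le> q * a / 4 * v t\<close> by simp
    finally have e: "(c / t)\<^sup>2 / 2 \<le> exp (q * a / 4 * v t)" by simp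
    have "t < \<sigma> * c\<^sup>2 / 2 / (\<bar>B\<bar> + 1)" using t d by linarith
    then have "\<bar>B\<bar> + 1 < \<sigma> * c\<^sup>2 / 2 / t" using t by (simp add: field_simps)
    also have "\<dots> = (c / t)\<^sup>2 / 2 * (\<sigma> * t)" using t by (simp add: field_simps power2_eq_square)
    also have "\<dots> \<le> exp (q * a / 4 * v t) * (\<sigma> * t)" using e \<sigma> t by (intro mult_right_mono) auto
    finally show ?thesis by simp
  qed
  define t1 where "t1 = d / 2"
  have t1: "0 < t1" "t1 < d" using d by (auto simp: t1_def)
  obtain N0 where N0: "v t1 / t1 < real N0" using reals_Archimedean2 by blast
  have "\<exists>Q. trig_poly n Q \<and> C * real n * weighted_norm p \<omega> Q < weighted_norm p \<omega> (deriv Q)" if n: "N0 \<le> n" for n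
  proof -
    have "v t1 / t1 \<le> real n" using N0 n by (meson less_le_trans less_imp_le of_nat_le_iff)
    then have vt1: "v t1 - real n * t1 \<le> 0" using t1 by (simp add: field_simps)
    \<comment> \<open>By \<open>d0 / 2 \<le> t * v t\<close>, this point is small enough for \<open>v\<close> to exceed \<open>n * t1 \<ge> n * t2\<close>.\<close>
    define t2 where "t2 = min t1 (d0 / 2 / (real n * t1 + 1))"
    have m: "0 < real n * t1 + 1" using t1 by (simp add: add_nonneg_pos)
    then have t2: "0 < t2" "t2 \<le> t1" "t2 \<le> d0 / 2 / (real n * t1 + 1)" using t1 d0 by (auto simp: t2_def)
    have vt2: "0 \<le> v t2 - real n * t2"
    proof -
      have "t2 * (real n * t1 + 1) \<le> d0 / 2" using t2(3) m by (simp add: field_simps)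
      also have "\<dots> \<le> t2 * v t2" using growth[of t2] t2 t1 d d0 by auto
      finally have "real n * t1 + 1 \<le> v t2" using t2(1) by simp
      moreover have "real n * t2 \<le> real n * t1" using t2 by (intro mult_left_mono) auto
      ultimately show ?thesis by linarith
    qed
    have "continuous_on {t2..t1} (\<lambda>t. v t - real n * t)"
    proof -
      have "\<omega> t \<noteq> 0" if "t \<in> {t2..t1}" for t
      proof -
        have "0 < t" "t < d0" using that t2(1) t1 d d0 by auto
        from D0[OF this] show ?thesis by simp
      qed
      moreover have "continuous_on {t2..t1} \<omega>" using w(1) by (rule continuous_on_subset) simp
      ultimately show ?thesis unfolding v_def by (intro continuous_intros) auto
    qed
    then obtain \<beta> where \<beta>: "t2 \<le> \<beta>" "\<beta> \<le> t1" "v \<beta> - real n * \<beta> = 0"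
      using IVT2'[of "\<lambda>t. v t - real n * t" t1 0 t2] vt1 vt2 t2(2) by blast
    have b: "0 < \<beta>" "\<beta> < d" "\<beta> < d0" "2 * \<beta> < d0" using \<beta> t2 t1 d d0 by linarith+
    have v\<beta>: "real n * \<beta> = v \<beta>" using \<beta>(3) by simp
    have exv: "\<omega> t = exp (- v t)" if "0 < t" "t < d0" for t using D0[OF that] by (simp add: v_def)
    have s\<beta>: "0 < \<sigma> * \<beta>" "\<sigma> * \<beta> < 1 * \<beta>" using \<sigma> b by (simp, intro mult_strict_right_mono)
    have e1: "0 < (1 - \<sigma>) * \<beta>" "(1 - \<sigma>) * \<beta> < d0" using s\<beta> b by (simp_all add: algebra_simps)
    have e2: "0 < (1 + \<sigma>) * \<beta>" "(1 + \<sigma>) * \<beta> < d0" using s\<beta> b unfolding distrib_right by linarith+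
    show ?thesis
    proof (rule bernstein_violation[OF w p C b(1) _ _ mono W, where n = n, folded q_def a_def, folded \<sigma>_def K_def, unfolded v\<beta>])
      show "\<beta> \<le> 1 / 2" "2 * \<beta> < \<epsilon>" using b d by linarith+
      show "\<omega> ((1 - \<sigma>) * \<beta>) \<le> exp (- (2 * q * v \<beta>))"
        unfolding exv[OF e1] using D0[OF b(1,3)] by simp
      have "4 / (q * a) * v ((1 + \<sigma>) * \<beta>) \<le> v \<beta>" using D0[OF e2] \<sigma> by simp
      then have "v ((1 + \<sigma>) * \<beta>) \<le> q * a / 4 * v \<beta>" using q a by (simp add: field_simps)
      then show "exp (- (q * a / 4 * v \<beta>)) \<le> \<omega> ((1 + \<sigma>) * \<beta>)" unfolding exv[OF e2] by simp
      show "K * (2 * pi * (1 + W)) * 2 powr q < exp (q * a / 4 * v \<beta>) * (\<sigma> * \<beta>)"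
        using big[OF b(1,2)] unfolding B_def .
    qed
  qed
  then show ?thesis by blast
qed

text \<open>
For each \<open>n\<close> the largest integer threshold up to \<open>n\<close> that can be reached is taken; the restriction to
thresholds up to \<open>n\<close> keeps the set finite without any bound on \<open>F n\<close>.
\<close>

lemma diagonal_choice:
  fixes F :: "nat \<Rightarrow> 'a \<Rightarrow> real"
  assumes base: "\<And>n. \<exists>x. P n x \<and> 0 \<le> F n x"
    and large: "\<And>C. \<exists>N. \<forall>n\<ge>N. \<exists>x. P n x \<and> real C \<le> F n x"
  shows "\<exists>x. (\<forall>n. P n (x n)) \<and> filterlim (\<lambda>n. F n (x n)) at_top sequentially"
proof -
  define S where "S n = {C. C \<le> n \<and> (\<exists>x. P n x \<and> real C \<le> F n x)}" for n
  have fin: "finite (S n)" for n unfolding S_def by (rule finite_subset[of _ "{..n}"]) auto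
  have "0 \<in> S n" for n unfolding S_def using base by simp
  then have "Max (S n) \<in> S n" for n using fin Max_in by blast
  then have "\<forall>n. \<exists>x. P n x \<and> real (Max (S n)) \<le> F n x" unfolding S_def by blast
  then obtain x where x: "\<And>n. P n (x n)" "\<And>n. real (Max (S n)) \<le> F n (x n)" by metis
  have "\<forall>\<^sub>F n in sequentially. Z \<le> F n (x n)" for Z
  proof -
    obtain C :: nat where C: "Z \<le> real C" using real_arch_simple by blast
    obtain N where N: "\<And>n. N \<le> n \<Longrightarrow> \<exists>y. P n y \<and> real C \<le> F n y" using large by blast
    have "Z \<le> F n (x n)" if "max N C \<le> n" for n
    proof -
      have "C \<in> S n" unfolding S_def using that N by simp
      then have "C \<le> Max (S n)" using fin by simp
      then show ?thesis using C x(2)[of n] by linarith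
    qed
    then show ?thesis unfolding eventually_sequentially by blast
  qed
  then show ?thesis using x(1) unfolding filterlim_at_top by blast
qed

theorem theorem1p3:
  fixes \<omega> :: "real \<Rightarrow> real" and \<epsilon> :: real
  assumes "weight \<omega>"
    and "continuous_on UNIV \<omega>"
    and "0 < \<epsilon>"
    and "antimono_on {-\<epsilon><..<0} \<omega>"
    and "\<omega> 0 = 0"
    and "mono_on {0<..<\<epsilon>} \<omega>"
    and "\<forall>\<^sub>F t in at 0. 0 < \<omega> t"
    and "\<And>r. 0 < r \<Longrightarrow> r < 1 \<Longrightarrow>
           filterlim (\<lambda>t. ln (\<omega> (r * t)) / ln (\<omega> t)) at_top (at 0)"
  shows "\<forall>p::ennreal. 0 < p \<longrightarrow>
           (\<exists>Q :: nat \<Rightarrow> real \<Rightarrow> real.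
              (\<forall>n. trig_poly n (Q n)) \<and>
              filterlim (\<lambda>n. weighted_norm p \<omega> (deriv (Q n)) /
                             (real n * weighted_norm p \<omega> (Q n))) at_top sequentially)"
proof (intro allI impI)
  fix p :: ennreal assume p: "0 < p"
  have w: "continuous_on UNIV \<omega>" "\<And>t. 0 \<le> \<omega> t" using assms(1,2) by (auto simp: weight_def)
  obtain e where e: "0 < e" "\<And>t. 0 < t \<Longrightarrow> t < e \<Longrightarrow> 0 < \<omega> t"
    using assms(7) unfolding eventually_at_split eventually_at_right_field by blast
  let ?F = "\<lambda>n Q. weighted_norm p \<omega> (deriv Q) / (real n * weighted_norm p \<omega> Q)"
  show "\<exists>Q. (\<forall>n. trig_poly n (Q n)) \<and> filterlim (\<lambda>n. ?F n (Q n)) at_top sequentially"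
  proof (rule diagonal_choice)
    show "\<exists>Q. trig_poly n Q \<and> 0 \<le> ?F n Q" for n
      using trig_poly_const[of n 0] weighted_norm_nonneg by (meson divide_nonneg_nonneg mult_nonneg_nonneg of_nat_0_le_iff)
  next
    fix C :: nat
    obtain N where N: "\<And>n. N \<le> n \<Longrightarrow> \<exists>Q. trig_poly n Q \<and>
        (1 + real C) * real n * weighted_norm p \<omega> Q < weighted_norm p \<omega> (deriv Q)"
      using bernstein_fails_eventually[OF w assms(3,6,5,7,8) p, of "1 + real C"] by auto
    have "\<exists>Q. trig_poly n Q \<and> real C \<le> ?F n Q" if n: "max N 1 \<le> n" for n
    proof -
      obtain Q where Q: "trig_poly n Q" "(1 + real C) * real n * weighted_norm p \<omega> Q < weighted_norm p \<omega> (deriv Q)"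
        using N n by auto
      \<comment> \<open>Otherwise both sides of the strict inequality would be 0.\<close>
      have "weighted_norm p \<omega> Q \<noteq> 0"
      proof
        assume z: "weighted_norm p \<omega> Q = 0"
        have "Q = (\<lambda>_. 0)" by (rule trig_poly_zero_norm[OF w p Q(1) e(2,1) z])
        then have "deriv Q = Q" by simp
        then show False using Q(2) z by simp
      qed
      then have "0 < weighted_norm p \<omega> Q" using weighted_norm_nonneg[of p \<omega> Q] by simp
      then have pos: "0 < real n * weighted_norm p \<omega> Q" using n by simp
      have "real C * (real n * weighted_norm p \<omega> Q) \<le> (1 + real C) * real n * weighted_norm p \<omega> Q"
        using pos by (simp add: algebra_simps)
      then have "real C \<le> ?F n Q" using Q(2) pos by (subst pos_le_divide_eq) linarith+
      then show ?thesis using Q(1) by blast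
    qed
    then show "\<exists>N. \<forall>n\<ge>N. \<exists>Q. trig_poly n Q \<and> real C \<le> ?F n Q" by blast
  qed
qed

end
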